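(* Let $Q\subset\mathbb{R}^{d+1}$ ($d\ge1$) be an open set and let $Lu=-u_t-\operatorname{tr}(aD^2u)-\langle b,Du\rangle+cu$, with $a$ taking values in the non-negative definite symmetric $d\times d$ matrices. Assume: (i) every point of $Q$ has a neighborhood on which the smallest eigenvalue of $a$ is bounded below by a positive constant; (ii) $b^\perp>0$ on $\partial_0Q$; (iii) $c\ge0$ on $Q$ and on $\partial_0Q$; (iv) $b$ and $c$ are locally bounded on $\underline{Q}$; (v) $a$ and $b$ are continuous along $\partial_0Q$ (as functions on $\underline{Q}$, they are continuous at every point of $\partial_0Q$). If $u\in C^2_s(\underline{Q})$ satisfies $Lu\le0$ on $Q$ and $u$ has a global positive maximum which is attained at a point $P^0\in\underline{Q}$, then $u=u(P^0)$ on $S(P^0)$.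
   Context: Points of $\mathbb{R}^{d+1}$ are written $P=(t,x)$, $t\in\mathbb{R}$, $x\in\mathbb{R}^d$; $D$ and $D^2$ are the gradient and Hessian in $x$ only. Let $a:Q\to\mathscr{S}^+(d)$ (non-negative definite symmetric matrices). The degenerate boundary $\partial_0Q$ is the intersection of the relative interior in $\partial Q$ (topological boundary) of $\{P\in\partial Q:\lim_{Q\ni P'\to P}a(P')=0\}$ with the relative interior in $\partial Q$ of the set of $P\in\partial Q$ at which $\partial Q$ has a tangent hyperplane whose normal vector has zero time component. Standing assumption: $\partial_0Q$ (possibly empty) is a $C^{1,\alpha}$ boundary portion, $Q$ lying locally on one side of it. Put $\underline{Q}:=Q\cup\partial_0Q$ and $a:=0$ on $\partial_0Q$. The coefficients $b$ ($\mathbb{R}^d$-valued) and $c$ (real-valued) are functions on $\underline{Q}$. Along $\partial_0Q$, $\vec n\in\mathbb{R}^d$ is the inward-pointing unit normal (its time component vanishes) and $b^\perp:=\langle b,\vec n\rangle$. $C^2_s(\underline{Q})$ is the set of $u$ such that $u,u_t,Du,D^2u$ are continuous on $Q$; $u,Du$ extend continuously to $\underline{Q}$; and $\operatorname{tr}(aD^2u)$ extends continuously to $\underline{Q}$ with value $0$ on $\partial_0Q$. "Global maximum" means maximum over $\underline{Q}$. For $P^0\in\underline{Q}$, $S(P^0)$ is the set of all $P\in\underline{Q}$ which can be connected to $P^0$ by a simple continuous curve in $\underline{Q}$ along which the time coordinate is non-increasing from $P$ to $P^0$.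
   Formalization: The formal theorem additionally assumes that a is locally bounded on Q; without this bound the claim as stated is false, already when the degenerate boundary is empty. *)

theory Defs
  imports "HOL-Analysis.Analysis"
begin

text \<open>Points of \<open>\<real>\<^sup>d\<^sup>+\<^sup>1\<close> are pairs \<open>(t, x)\<close> of type \<open>real \<times> (real^'n)\<close>, with \<open>d = CARD('n)\<close>.\<close>

subsection \<open>Linear algebra\<close>

definition nonneg_definite_symmetric :: "real^'n^'n \<Rightarrow> bool" where
  "nonneg_definite_symmetric A \<longleftrightarrow> transpose A = A \<and> (\<forall>v. 0 \<le> v \<bullet> (A *v v))"

definition eigenvalues :: "real^'n^'n \<Rightarrow> real set" where
  "eigenvalues A = {k. \<exists>v. v \<noteq> 0 \<and> A *v v = k *\<^sub>R v}"

text \<open>Only used for symmetric matrices, whose set of real eigenvalues is finite and nonempty.\<close>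
definition smallest_eigenvalue :: "real^'n^'n \<Rightarrow> real" where
  "smallest_eigenvalue A = Min (eigenvalues A)"

subsection \<open>Geometry of the boundary\<close>

definition tangent_cone :: "'a::real_normed_vector set \<Rightarrow> 'a \<Rightarrow> 'a set" where
  "tangent_cone S p = {v. \<exists>s w. (\<forall>k::nat. 0 < s k \<and> p + s k *\<^sub>R w k \<in> S) \<and>
     s \<longlonglongrightarrow> (0::real) \<and> w \<longlonglongrightarrow> v}"

text \<open>The affine hyperplane through \<open>p\<close> with normal vector \<open>\<nu>\<close> is tangent to \<open>S\<close> at \<open>p\<close>: the
  (Bouligand) tangent cone of \<open>S\<close> at \<open>p\<close> is the whole linear hyperplane orthogonal to \<open>\<nu>\<close>.\<close>
definition tangent_hyperplane_with_normal :: "'a::real_inner set \<Rightarrow> 'a \<Rightarrow> 'a \<Rightarrow> bool" where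
  "tangent_hyperplane_with_normal S p \<nu> \<longleftrightarrow> \<nu> \<noteq> 0 \<and> tangent_cone S p = {v. \<nu> \<bullet> v = 0}"

text \<open>Only the values of \<open>a\<close> on \<open>Q\<close> matter here: for open \<open>Q\<close>, a boundary point is never in \<open>Q\<close>.\<close>
definition degenerate_boundary ::
    "(real \<times> (real^'n)) set \<Rightarrow> (real \<times> (real^'n) \<Rightarrow> real^'n^'n) \<Rightarrow> (real \<times> (real^'n)) set" where
  "degenerate_boundary Q a =
     (top_of_set (frontier Q) interior_of {P \<in> frontier Q. (a \<longlongrightarrow> 0) (at P within Q)}) \<inter>
     (top_of_set (frontier Q) interior_of
        {P \<in> frontier Q. \<exists>n. tangent_hyperplane_with_normal (frontier Q) P (0, n)})"

definition with_degenerate_boundary ::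
    "(real \<times> (real^'n)) set \<Rightarrow> (real \<times> (real^'n) \<Rightarrow> real^'n^'n) \<Rightarrow> (real \<times> (real^'n)) set" where
  "with_degenerate_boundary Q a = Q \<union> degenerate_boundary Q a"

definition C1_holder_on :: "real \<Rightarrow> 'a::real_inner set \<Rightarrow> ('a \<Rightarrow> real) \<Rightarrow> bool" where
  "C1_holder_on \<alpha> U f \<longleftrightarrow> (\<exists>g C. (\<forall>x\<in>U. GDERIV f x :> g x) \<and>
     (\<forall>x\<in>U. \<forall>y\<in>U. norm (g x - g y) \<le> C * dist x y powr \<alpha>))"

text \<open>Near each of its points, \<open>T\<close> is a piece of the graph, over the hyperplane orthogonal to a unit
  vector \<open>e\<close>, of a \<open>C\<^sup>1\<^sup>,\<^sup>\<alpha>\<close> function \<open>f\<close>, and \<open>Q\<close> is the side of this graph towards which \<open>e\<close>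
  points. The vector \<open>x - (e \<bullet> x) *\<^sub>R e\<close> is the projection of \<open>x\<close> to that hyperplane. Only the
  values of \<open>f\<close> on the hyperplane matter; a \<open>C\<^sup>1\<^sup>,\<^sup>\<alpha>\<close> function on an open part of the hyperplane can be
  extended to be constant in direction \<open>e\<close>.\<close>
definition C1_holder_boundary_portion :: "real \<Rightarrow> 'a::real_inner set \<Rightarrow> 'a set \<Rightarrow> bool" where
  "C1_holder_boundary_portion \<alpha> Q T \<longleftrightarrow> T \<subseteq> frontier Q \<and>
     (\<forall>p\<in>T. \<exists>r>0. \<exists>e f. norm e = 1 \<and> C1_holder_on \<alpha> (ball (p - (e \<bullet> p) *\<^sub>R e) r) f \<and>
        Q \<inter> ball p r = {x \<in> ball p r. f (x - (e \<bullet> x) *\<^sub>R e) < e \<bullet> x})"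

text \<open>The spatial part of the inward unit normal at a boundary point where the normal has
  vanishing time component.\<close>
definition inward_normal :: "(real \<times> (real^'n)) set \<Rightarrow> real \<times> (real^'n) \<Rightarrow> real^'n" where
  "inward_normal Q P = (THE n. norm n = 1 \<and> tangent_hyperplane_with_normal (frontier Q) P (0, n) \<and>
     (\<exists>\<delta>>0. \<forall>s. 0 < s \<and> s < \<delta> \<longrightarrow> P + s *\<^sub>R (0, n) \<in> Q))"

definition b_perp ::
    "(real \<times> (real^'n)) set \<Rightarrow> (real \<times> (real^'n) \<Rightarrow> real^'n) \<Rightarrow> real \<times> (real^'n) \<Rightarrow> real" where
  "b_perp Q b P = b P \<bullet> inward_normal Q P"

subsection \<open>Derivatives and the operator\<close>

definition time_deriv :: "(real \<times> (real^'n) \<Rightarrow> real) \<Rightarrow> real \<times> (real^'n) \<Rightarrow> real" where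
  "time_deriv u P = deriv (\<lambda>t. u (t, snd P)) (fst P)"

definition space_grad :: "(real \<times> (real^'n) \<Rightarrow> real) \<Rightarrow> real \<times> (real^'n) \<Rightarrow> real^'n" where
  "space_grad u P = (THE g. GDERIV (\<lambda>x. u (fst P, x)) (snd P) :> g)"

definition space_hessian :: "(real \<times> (real^'n) \<Rightarrow> real) \<Rightarrow> real \<times> (real^'n) \<Rightarrow> real^'n^'n" where
  "space_hessian u P = jacobian (\<lambda>x. space_grad u (fst P, x)) (at (snd P))"

definition parabolic_op ::
    "(real \<times> (real^'n) \<Rightarrow> real^'n^'n) \<Rightarrow> (real \<times> (real^'n) \<Rightarrow> real^'n) \<Rightarrow> (real \<times> (real^'n) \<Rightarrow> real) \<Rightarrow>
     (real \<times> (real^'n) \<Rightarrow> real) \<Rightarrow> real \<times> (real^'n) \<Rightarrow> real" where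
  "parabolic_op a b c u P =
     - time_deriv u P - trace (a P ** space_hessian u P) - b P \<bullet> space_grad u P + c P * u P"

text \<open>A function \<open>u\<close> of this class is already regarded as a function on \<open>Q\<close> together with its
  degenerate boundary; \<open>G\<close> and \<open>h\<close> are the continuous extensions of the gradient and of
  \<open>tr (a D\<^sup>2 u)\<close>. Values of \<open>u\<close> elsewhere are irrelevant.\<close>
definition C2s ::
    "(real \<times> (real^'n)) set \<Rightarrow> (real \<times> (real^'n) \<Rightarrow> real^'n^'n) \<Rightarrow> (real \<times> (real^'n) \<Rightarrow> real) set" where
  "C2s Q a = {u.
     (\<forall>P\<in>Q. (\<lambda>t. u (t, snd P)) differentiable at (fst P)) \<and>
     (\<forall>P\<in>Q. (\<lambda>x. u (fst P, x)) differentiable at (snd P)) \<and>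
     (\<forall>P\<in>Q. (\<lambda>x. space_grad u (fst P, x)) differentiable at (snd P)) \<and>
     continuous_on Q (time_deriv u) \<and>
     continuous_on Q (space_hessian u) \<and>
     continuous_on (with_degenerate_boundary Q a) u \<and>
     (\<exists>G. continuous_on (with_degenerate_boundary Q a) G \<and> (\<forall>P\<in>Q. G P = space_grad u P)) \<and>
     (\<exists>h. continuous_on (with_degenerate_boundary Q a) h \<and>
        (\<forall>P\<in>Q. h P = trace (a P ** space_hessian u P)) \<and> (\<forall>P\<in>degenerate_boundary Q a. h P = 0))}"

subsection \<open>Further notions\<close>

text \<open>In the maximum principle, local boundedness is required of \<open>b\<close>, \<open>c\<close> and also of \<open>a\<close> on \<open>Q\<close>.
  The last requirement is essential: let \<open>d = 2\<close>, \<open>Q = {\<bar>x\<^sub>1\<bar> < 1, \<bar>x\<^sub>2\<bar> < 1}\<close>, \<open>b = 0\<close>, \<open>c = 0\<close> and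
  \<open>a = diag(1, A)\<close> with \<open>A = 3 (2 - x\<^sub>2\<^sup>2) / x\<^sub>1\<^sup>2\<close> for \<open>x\<^sub>1 > 0\<close> and \<open>A = 1\<close> for \<open>x\<^sub>1 \<le> 0\<close>. Both
  eigenvalues of \<open>a\<close> are at least 1, and the degenerate boundary is empty. The nonconstant function
  \<open>u = 1 - (max 0 x\<^sub>1)\<^sup>3 (2 - x\<^sub>2\<^sup>2)\<close> is twice continuously differentiable, satisfies \<open>Lu = 0\<close> and
  has the positive global maximum 1, attained exactly where \<open>x\<^sub>1 \<le> 0\<close>.\<close>
definition locally_bounded_on :: "'a::metric_space set \<Rightarrow> ('a \<Rightarrow> 'b::metric_space) \<Rightarrow> bool" where
  "locally_bounded_on S f \<longleftrightarrow> (\<forall>x\<in>S. \<exists>r>0. bounded (f ` (ball x r \<inter> S)))"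

text \<open>The set \<open>S(P\<^sup>0)\<close>, relative to a set \<open>X\<close> (to be taken as \<open>Q\<close> with its degenerate boundary).\<close>
definition time_reachable ::
    "(real \<times> (real^'n)) set \<Rightarrow> real \<times> (real^'n) \<Rightarrow> (real \<times> (real^'n)) set" where
  "time_reachable X P0 = {P \<in> X. \<exists>g. simple_path g \<and> path_image g \<subseteq> X \<and>
     pathstart g = P \<and> pathfinish g = P0 \<and> monotone_on {0..1} (\<le>) (\<ge>) (fst \<circ> g)}"

end

theory Submission
  imports Defs
begin

text \<open>Let \<open>M > 0\<close> be the maximum. Where \<open>u \<ge> 0\<close>, also \<open>c u \<ge> 0\<close>, and \<open>Lu \<le> 0\<close> gives
  \<open>u\<^sub>t + tr (a D\<^sup>2u) + \<langle>b, Du\<rangle> \<ge> 0\<close>, a backward parabolic inequality. It is enough to show that every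
  point \<open>P\<close> with \<open>u P = M\<close> has a neighbourhood in which \<open>u = M\<close> at all points whose time is not less than
  that of \<open>P\<close>: a path along which time does not decrease then cannot leave the set \<open>{u = M}\<close>
  (\<open>max_propagates_along_path\<close>).

  For \<open>P = (t\<^sub>1, x\<^sub>1)\<close> in \<open>Q\<close>, suppose that \<open>u < M\<close> at a nearby point \<open>(t\<^sub>3, x\<^sub>3)\<close> with \<open>t\<^sub>3 > t\<^sub>1\<close>. Join the
  two points by a straight line \<open>t \<mapsto> X(t)\<close> and put
  \<open>w = exp (\<kappa> (t - t\<^sub>3)) (\<delta>\<^sup>2 - \<bar>x - X(t)\<bar>\<^sup>2)\<^sup>2\<close> on the tube \<open>\<bar>x - X(t)\<bar> \<le> \<delta>\<close>. For large \<open>\<kappa>\<close> this is a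
  strict subsolution: near the lateral surface the second derivatives win by ellipticity, elsewhere
  the factor \<open>\<kappa>\<close> does. So \<open>u + \<epsilon> w\<close> has no maximum before time \<open>t\<^sub>3\<close> in the open tube, not even at its
  initial time \<open>t\<^sub>1\<close>, because a maximum over present and later times is already contradictory for a
  backward inequality. On the rest of the boundary of the tube \<open>u + \<epsilon> w \<le> M\<close> for small \<open>\<epsilon>\<close>, whereas
  \<open>u + \<epsilon> w > M\<close> at \<open>(t\<^sub>1, x\<^sub>1)\<close> (\<open>max_propagates_forward_in_ball\<close>).

  On the degenerate boundary the inequality turns into a transport inequality along the direction
  \<open>(1, b)\<close>, which points into \<open>Q\<close> because \<open>b\<^sup>\<bottom> > 0\<close> and the normal is purely spatial. Therefore \<open>u + \<epsilon> w\<close>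
  cannot have a maximum there either if \<open>w\<^sub>t + \<langle>b, Dw\<rangle> > 0\<close>: following \<open>(1, b)\<close> increases it
  (\<open>no_degenerate_boundary_max\<close>). If now \<open>u = M\<close> at a degenerate boundary point \<open>P\<^sub>1\<close> but \<open>u < M\<close> in \<open>Q\<close>
  near \<open>P\<^sub>1\<close>, let \<open>m\<close> be an inward normal and consider \<open>w = \<langle>m, x - x\<^sub>1\<rangle> - (k / \<rho>) \<bar>P - P\<^sub>1\<bar>\<^sup>2\<close> on a thin
  cap of radius \<open>\<rho>\<close>. On its rim \<open>w < 0\<close>, on its lid \<open>u\<close> is bounded away from \<open>M\<close>, and
  elsewhere a maximum of \<open>u + \<epsilon> w\<close> is excluded, although the value at \<open>P\<^sub>1\<close> is \<open>M\<close>. Hence \<open>u = M\<close> at points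
  of \<open>Q\<close> arbitrarily near \<open>P\<^sub>1\<close> (\<open>degenerate_max_approached_from_interior\<close>). From these every later point
  of \<open>Q\<close> near \<open>P\<^sub>1\<close> is reached inside \<open>Q\<close> by a polygon along which time does not decrease, and continuity
  gives the remaining points (\<open>degenerate_max_locally_constant\<close>).\<close>

section \<open>Nonnegative definite matrices\<close>

definition outer :: "real^'n \<Rightarrow> real^'n \<Rightarrow> real^'n^'n" where
  "outer v w = (\<chi> i j. v $ i * w $ j)"

lemma outer_mult_vec: "outer v w *v x = (w \<bullet> x) *\<^sub>R v"
  by (simp add: vec_eq_iff outer_def matrix_vector_mult_def inner_vec_def sum_distrib_left
      sum_distrib_right mult_ac)

lemma transpose_outer: "transpose (outer v v) = outer v v"
  by (simp add: vec_eq_iff outer_def transpose_def mult_ac)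

lemma trace_mult_outer: "trace (A ** outer v w) = w \<bullet> (A *v v)"
  by (simp add: trace_def outer_def matrix_matrix_mult_def matrix_vector_mult_def inner_vec_def
      sum_distrib_left sum_distrib_right mult_ac)

lemma trace_outer_mult: "trace (outer v w ** A) = w \<bullet> (A *v v)"
  by (metis trace_mul_sym trace_mult_outer)

lemma trace_scaleR: "trace (c *\<^sub>R A) = c * trace (A :: real^'n^'n)"
  by (simp add: trace_def sum_distrib_left)

lemma matrix_mult_scaleR_right: "A ** (c *\<^sub>R B) = c *\<^sub>R (A ** B)" for A B :: "real^'n^'n"
  by (simp add: vec_eq_iff matrix_matrix_mult_def sum_distrib_left mult_ac)

lemma trace_mult_diff: "trace (A ** (B - C)) = trace (A ** B) - trace (A ** C)"
  for A B C :: "real^'n^'n"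
  by (simp add: trace_def matrix_matrix_mult_def right_diff_distrib sum_subtractf)

lemma abs_trace_le: "\<bar>trace A\<bar> \<le> real CARD('n) * norm A" for A :: "real^'n^'n"
proof -
  have "\<bar>trace A\<bar> \<le> (\<Sum>i\<in>(UNIV::'n set). \<bar>A $ i $ i\<bar>)"
    unfolding trace_def by (rule sum_abs)
  also have "\<dots> \<le> (\<Sum>i\<in>(UNIV::'n set). norm A)"
  proof (rule sum_mono)
    fix i
    show "\<bar>A $ i $ i\<bar> \<le> norm A"
      using component_le_norm_cart[of "A $ i" i] Finite_Cartesian_Product.norm_nth_le[of A i] by linarith
  qed
  finally show ?thesis by simp
qed

lemma sym_matrix_inner: "transpose A = A \<Longrightarrow> v \<bullet> (A *v w) = w \<bullet> (A *v v)" for A :: "real^'n^'n"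
  by (metis dot_lmul_matrix inner_commute transpose_matrix_vector)

text \<open>A nonnegative quadratic form attains its minimum at \<open>e\<close>, so its derivative there, which is
  \<open>2 A e\<close>, vanishes. Concretely, the form is evaluated at \<open>e - s A e\<close> for a small \<open>s > 0\<close>.\<close>
lemma nonneg_quadratic_null_vector:
  fixes A :: "real^'n^'n"
  assumes "nonneg_definite_symmetric A" "e \<bullet> (A *v e) = 0"
  shows "A *v e = 0"
proof -
  define q where "q = A *v e"
  have sym: "transpose A = A" and psd: "\<And>v. 0 \<le> v \<bullet> (A *v v)"
    using assms(1) by (auto simp: nonneg_definite_symmetric_def)
  have expand: "(e + s *\<^sub>R q) \<bullet> (A *v (e + s *\<^sub>R q)) = 2 * s * (q \<bullet> q) + s\<^sup>2 * (q \<bullet> (A *v q))" for s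
    using assms(2) sym_matrix_inner[OF sym, of e q]
    by (simp add: q_def matrix_vector_right_distrib matrix_vector_mult_scaleR inner_add_left inner_add_right
        power2_eq_square algebra_simps)
  define K where "K = q \<bullet> (A *v q) + 1"
  have K: "K > 0" using psd[of q] by (simp add: K_def)
  show ?thesis
  proof (rule ccontr)
    assume "A *v e \<noteq> 0"
    then have qq: "q \<bullet> q > 0" by (simp add: q_def)
    have "0 \<le> 2 * (- (q \<bullet> q) / K) * (q \<bullet> q) + (- (q \<bullet> q) / K)\<^sup>2 * (q \<bullet> (A *v q))"
      using psd[of "e + (- (q \<bullet> q) / K) *\<^sub>R q"] unfolding expand .
    also have "\<dots> = ((q \<bullet> q)\<^sup>2 / K) * ((q \<bullet> (A *v q)) / K - 2)"
      using K by (simp add: field_simps power2_eq_square)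
    finally have "(q \<bullet> (A *v q)) / K - 2 \<ge> 0"
      using K qq by (auto simp: zero_le_mult_iff zero_le_divide_iff)
    moreover have "(q \<bullet> (A *v q)) / K < 1" using K by (simp add: K_def)
    ultimately show False by simp
  qed
qed

text \<open>One step of Cholesky elimination: subtracting \<open>q q\<^sup>T / A\<^sub>i\<^sub>i\<close>, with \<open>q\<close> the \<open>i\<close>-th column of \<open>A\<close>, keeps
  \<open>A\<close> nonnegative definite and clears its \<open>i\<close>-th row, and \<open>tr (q q\<^sup>T H) = \<langle>q, H q\<rangle> \<le> 0\<close>. The set \<open>I\<close> records
  the rows that are still to be cleared.\<close>
lemma trace_mult_nonpos_supported:
  fixes A H :: "real^'n^'n"
  assumes "finite I" "nonneg_definite_symmetric A" "\<And>i j. i \<notin> I \<Longrightarrow> A $ i $ j = 0"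
    and H: "\<And>v. v \<bullet> (H *v v) \<le> 0"
  shows "trace (A ** H) \<le> 0"
  using assms(1-3)
proof (induction I arbitrary: A rule: finite_induct)
  case empty
  then have "A = 0" by (simp add: vec_eq_iff)
  then show ?case by (simp add: trace_def)
next
  case (insert i I)
  have sym: "transpose A = A" and psd: "\<And>v. 0 \<le> v \<bullet> (A *v v)"
    using insert.prems(1) by (auto simp: nonneg_definite_symmetric_def)
  define e :: "real^'n" where "e = axis i 1"
  define q where "q = A *v e"
  have q_nth: "q $ j = A $ j $ i" for j
    by (simp add: q_def e_def matrix_vector_mult_basis column_def)
  have symij: "A $ j $ k = A $ k $ j" for j k
    by (metis sym transpose_def vec_lambda_beta)
  have eAe: "e \<bullet> (A *v e) = A $ i $ i"
    using q_nth[of i] by (simp add: q_def e_def inner_axis')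
  show ?case
  proof (cases "A $ i $ i = 0")
    case True
    then have "q = 0"
      unfolding q_def using nonneg_quadratic_null_vector[OF insert.prems(1)] eAe by simp
    then have "A $ i $ j = 0" for j
      using q_nth[of j] symij[of i j] by simp
    then show ?thesis
      by (intro insert.IH[OF insert.prems(1)]) (metis insert.prems(2) insertE)
  next
    case False
    define p where "p = A $ i $ i"
    have p: "p > 0" using False psd[of e] eAe by (simp add: p_def)
    define B where "B = A - (1/p) *\<^sub>R outer q q"
    have Bv: "B *v v = A *v v - ((q \<bullet> v) / p) *\<^sub>R q" for v
      by (simp add: B_def matrix_vector_mult_diff_rdistrib outer_mult_vec
          flip: scaleR_matrix_vector_assoc)
    have "0 \<le> v \<bullet> (B *v v)" for v
    proof -
      define s where "s = (q \<bullet> v) / p"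
      have "0 \<le> (v - s *\<^sub>R e) \<bullet> (A *v (v - s *\<^sub>R e))" by (rule psd)
      also have "\<dots> = v \<bullet> (A *v v) - 2 * s * (q \<bullet> v) + s\<^sup>2 * p"
        using sym_matrix_inner[OF sym, of e v] eAe
        by (simp add: p_def q_def matrix_vector_mult_diff_distrib matrix_vector_mult_scaleR
            inner_diff_left inner_diff_right power2_eq_square inner_commute algebra_simps)
      also have "\<dots> = v \<bullet> (B *v v)"
        using p by (simp add: Bv s_def inner_diff_right inner_commute field_simps power2_eq_square)
      finally show ?thesis .
    qed
    moreover have "transpose B = B"
      using sym transpose_outer[of q] by (simp add: B_def transpose_def vec_eq_iff)
    ultimately have "nonneg_definite_symmetric B"
      by (simp add: nonneg_definite_symmetric_def)
    moreover have "B $ j $ k = 0" if "j \<notin> I" for j k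
    proof (cases "j = i")
      case True
      then show ?thesis
        using p symij[of i k] by (simp add: B_def outer_def q_nth p_def)
    next
      case False
      then show ?thesis
        using that insert.prems(2) by (simp add: B_def outer_def q_nth)
    qed
    ultimately have "trace (B ** H) \<le> 0" by (rule insert.IH)
    moreover have "A ** H = B ** H + (1/p) *\<^sub>R (outer q q ** H)"
      by (simp add: B_def vec_eq_iff matrix_matrix_mult_def sum_distrib_left
          left_diff_distrib right_diff_distrib mult_ac flip: sum.distrib)
    then have "trace (A ** H) = trace (B ** H) + (q \<bullet> (H *v q)) / p"
      by (simp add: trace_add trace_scaleR trace_outer_mult)
    moreover have "(q \<bullet> (H *v q)) / p \<le> 0"
      using H[of q] p by (simp add: divide_nonpos_pos)
    ultimately show ?thesis by linarith
  qed
qed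

lemma trace_mult_nonpos:
  fixes A H :: "real^'n^'n"
  assumes "nonneg_definite_symmetric A" "\<And>v. v \<bullet> (H *v v) \<le> 0"
  shows "trace (A ** H) \<le> 0"
  by (rule trace_mult_nonpos_supported[of UNIV A H]) (use assms in auto)

text \<open>Eigenvectors of a symmetric matrix to different eigenvalues are orthogonal, hence linearly
  independent.\<close>
lemma finite_eigenvalues:
  fixes A :: "real^'n^'n"
  assumes sym: "transpose A = A"
  shows "finite (eigenvalues A)"
proof -
  define ev where "ev k = (SOME v. v \<noteq> 0 \<and> A *v v = k *\<^sub>R v)" for k
  have ev: "ev k \<noteq> 0 \<and> A *v ev k = k *\<^sub>R ev k" if "k \<in> eigenvalues A" for k
    unfolding ev_def using that unfolding eigenvalues_def by (metis (mono_tags, lifting) mem_Collect_eq someI_ex)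
  have orth: "ev k \<bullet> ev l = 0" if "k \<in> eigenvalues A" "l \<in> eigenvalues A" "k \<noteq> l" for k l
    using sym_matrix_inner[OF sym, of "ev k" "ev l"] ev[OF that(1)] ev[OF that(2)] that(3)
    by (simp add: inner_commute)
  have "inj_on ev (eigenvalues A)"
    using orth ev by (metis inj_onI inner_eq_zero_iff)
  moreover have "pairwise orthogonal (ev ` eigenvalues A)"
    using orth by (auto simp: pairwise_def orthogonal_def)
  then have "independent (ev ` eigenvalues A)"
    using ev by (intro pairwise_orthogonal_independent) auto
  then have "finite (ev ` eigenvalues A)"
    by (rule independent_imp_finite)
  ultimately show ?thesis by (simp add: finite_image_iff)
qed

text \<open>The minimum of the Rayleigh quotient is an eigenvalue: if it is \<open>\<mu>\<close> and attained at \<open>e\<close>, then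
  \<open>A - \<mu>\<close> is nonnegative definite and \<open>e\<close> is a null vector of its quadratic form.\<close>
lemma smallest_eigenvalue_le_quadratic:
  fixes A :: "real^'n^'n"
  assumes sym: "transpose A = A"
  shows "smallest_eigenvalue A * (v \<bullet> v) \<le> v \<bullet> (A *v v)"
proof -
  have "compact (sphere (0::real^'n) 1)" "sphere (0::real^'n) 1 \<noteq> {}" by auto
  moreover have "continuous_on (sphere 0 1) (\<lambda>v. v \<bullet> (A *v v))"
    by (intro continuous_intros)
  ultimately obtain e where e: "e \<in> sphere 0 1" "\<And>v. v \<in> sphere 0 1 \<Longrightarrow> e \<bullet> (A *v e) \<le> v \<bullet> (A *v v)"
    using continuous_attains_inf[of "sphere 0 1" "\<lambda>v. v \<bullet> (A *v v)"] by blast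
  define \<mu> where "\<mu> = e \<bullet> (A *v e)"
  have ee: "e \<bullet> e = 1" using e(1) by (simp add: dot_square_norm)
  have ray: "\<mu> * (w \<bullet> w) \<le> w \<bullet> (A *v w)" for w
  proof (cases "w = 0")
    case False
    then have "\<mu> \<le> ((1 / norm w) *\<^sub>R w) \<bullet> (A *v ((1 / norm w) *\<^sub>R w))"
      unfolding \<mu>_def by (intro e(2)) simp
    then show ?thesis using False
      by (simp add: matrix_vector_mult_scaleR dot_square_norm field_simps power2_eq_square)
  qed auto
  define B where "B = A - \<mu> *\<^sub>R mat 1"
  have Bv: "B *v w = A *v w - \<mu> *\<^sub>R w" for w
    by (simp add: B_def matrix_vector_mult_diff_rdistrib flip: scaleR_matrix_vector_assoc)
  have "transpose B = B"
    using sym by (auto simp: B_def transpose_def vec_eq_iff mat_def)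
  then have "nonneg_definite_symmetric B"
    using ray by (simp add: nonneg_definite_symmetric_def Bv inner_diff_right)
  moreover have "e \<bullet> (B *v e) = 0" by (simp add: Bv inner_diff_right ee \<mu>_def)
  ultimately have "B *v e = 0" by (rule nonneg_quadratic_null_vector)
  then have "A *v e = \<mu> *\<^sub>R e" by (simp add: Bv)
  moreover have "e \<noteq> 0" using ee by auto
  ultimately have "\<mu> \<in> eigenvalues A" by (auto simp: eigenvalues_def)
  then have "smallest_eigenvalue A \<le> \<mu>"
    unfolding smallest_eigenvalue_def by (intro Min_le finite_eigenvalues sym)
  then have "smallest_eigenvalue A * (v \<bullet> v) \<le> \<mu> * (v \<bullet> v)"
    by (intro mult_right_mono) auto
  with ray[of v] show ?thesis by simp
qed

section \<open>Second-order conditions at a maximum\<close>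

lemma second_derivative_nonpos_at_max:
  fixes y :: "'a::euclidean_space \<Rightarrow> real"
  assumes "\<delta> > 0"
    and grad: "\<And>z. z \<in> ball x \<delta> \<Longrightarrow> GDERIV y z :> g z"
    and hess: "(g has_derivative H) (at x)"
    and max: "\<And>z. z \<in> ball x \<delta> \<Longrightarrow> y z \<le> y x"
  shows "g x = 0" "v \<bullet> H v \<le> 0"
proof -
  have "(y has_derivative (\<lambda>h. h \<bullet> g x)) (at x)"
    using grad[of x] \<open>\<delta> > 0\<close> by (simp add: gderiv_def)
  then have "(\<lambda>h. h \<bullet> g x) = (\<lambda>v. 0)"
    using max \<open>\<delta> > 0\<close> by (intro differential_zero_maxmin[of x "ball x \<delta>" y]) auto
  then have "g x \<bullet> g x = 0" by metis
  then show gx: "g x = 0" by simp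
  show "v \<bullet> H v \<le> 0"
  proof (rule ccontr)
    assume "\<not> v \<bullet> H v \<le> 0"
    then have pos: "v \<bullet> H v > 0" by simp
    have lin: "bounded_linear H" using hess by (rule has_derivative_bounded_linear)
    then have "v \<noteq> 0" using pos by (auto simp: linear_simps)
    have line: "((\<lambda>s::real. x + s *\<^sub>R v) has_derivative (\<lambda>s. s *\<^sub>R v)) (at s)" for s
      by (auto intro!: derivative_eq_intros)
    have "((\<lambda>s. g (x + s *\<^sub>R v)) has_derivative (\<lambda>s. H (s *\<^sub>R v))) (at 0)"
      using has_derivative_compose[OF line[of 0], of g H] hess by simp
    then have "((\<lambda>s. v \<bullet> g (x + s *\<^sub>R v)) has_derivative (\<lambda>s. v \<bullet> H (s *\<^sub>R v))) (at 0)"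
      by (rule has_derivative_inner_right)
    then have "((\<lambda>s. v \<bullet> g (x + s *\<^sub>R v)) has_real_derivative (v \<bullet> H v)) (at 0)"
      using lin by (simp add: has_field_derivative_def linear_simps mult_commute_abs)
    from DERIV_pos_inc_right[OF this pos] obtain d where
      d: "d > 0" "\<And>s. 0 < s \<Longrightarrow> s < d \<Longrightarrow> 0 < v \<bullet> g (x + s *\<^sub>R v)"
      using gx by auto
    define s where "s = min (d/2) (\<delta> / (2 * norm v))"
    have s: "0 < s" "s < d" using d(1) \<open>\<delta> > 0\<close> \<open>v \<noteq> 0\<close> by (auto simp: s_def)
    have inball: "x + r *\<^sub>R v \<in> ball x \<delta>" if "0 \<le> r" "r \<le> s" for r
    proof -
      have "r * norm v \<le> (\<delta> / (2 * norm v)) * norm v"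
        using that by (intro mult_right_mono) (auto simp: s_def)
      also have "\<dots> < \<delta>" using \<open>\<delta> > 0\<close> \<open>v \<noteq> 0\<close> by simp
      finally show ?thesis using that by (simp add: dist_norm)
    qed
    have deriv: "((\<lambda>s. y (x + s *\<^sub>R v)) has_real_derivative (v \<bullet> g (x + r *\<^sub>R v))) (at r)"
      if "0 \<le> r" "r \<le> s" for r
    proof -
      have "(y has_derivative (\<lambda>h. h \<bullet> g (x + r *\<^sub>R v))) (at (x + r *\<^sub>R v))"
        using grad[OF inball[OF that]] by (simp add: gderiv_def)
      then have "((\<lambda>s. y (x + s *\<^sub>R v)) has_derivative (\<lambda>s. s *\<^sub>R v \<bullet> g (x + r *\<^sub>R v))) (at r)"
        by (rule has_derivative_compose[OF line[of r]])
      then show ?thesis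
        by (simp add: has_field_derivative_def mult_commute_abs)
    qed
    obtain r where r: "0 < r" "r < s" "y (x + s *\<^sub>R v) - y (x + 0 *\<^sub>R v) = (s - 0) * (v \<bullet> g (x + r *\<^sub>R v))"
      using MVT2[OF s(1), of "\<lambda>s. y (x + s *\<^sub>R v)" "\<lambda>r. v \<bullet> g (x + r *\<^sub>R v)"] deriv by blast
    moreover have "s * (v \<bullet> g (x + r *\<^sub>R v)) > 0" using r d(2)[of r] s by simp
    ultimately have "y (x + s *\<^sub>R v) > y x" by simp
    with max[OF inball[of s]] s show False by simp
  qed
qed

text \<open>Only times after \<open>t\<^sub>0\<close> are compared, so the time derivative is merely nonpositive. This one-sided
  form also applies on the initial face of a space-time region.\<close>
lemma parabolic_expr_nonpos_at_max:
  fixes y :: "real \<times> (real^'n) \<Rightarrow> real" and A H :: "real^'n^'n"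
  assumes "\<delta> > 0"
    and time: "((\<lambda>t. y (t, x\<^sub>0)) has_real_derivative yt) (at t\<^sub>0)"
    and grad: "\<And>x. x \<in> ball x\<^sub>0 \<delta> \<Longrightarrow> GDERIV (\<lambda>x. y (t\<^sub>0, x)) x :> g x"
    and hess: "(g has_derivative (\<lambda>h. H *v h)) (at x\<^sub>0)"
    and max_time: "\<And>t. t\<^sub>0 < t \<Longrightarrow> t < t\<^sub>0 + \<delta> \<Longrightarrow> y (t, x\<^sub>0) \<le> y (t\<^sub>0, x\<^sub>0)"
    and max_space: "\<And>x. x \<in> ball x\<^sub>0 \<delta> \<Longrightarrow> y (t\<^sub>0, x) \<le> y (t\<^sub>0, x\<^sub>0)"
    and A: "nonneg_definite_symmetric A"
  shows "yt + trace (A ** H) + \<beta> \<bullet> g x\<^sub>0 \<le> 0"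
proof -
  note sd = second_derivative_nonpos_at_max[OF \<open>\<delta> > 0\<close> grad hess max_space]
  have "yt \<le> 0"
  proof (rule ccontr)
    assume "\<not> yt \<le> 0"
    then obtain d where d: "d > 0" "\<And>h. 0 < h \<Longrightarrow> h < d \<Longrightarrow> y (t\<^sub>0, x\<^sub>0) < y (t\<^sub>0 + h, x\<^sub>0)"
      using DERIV_pos_inc_right[OF time] by auto
    define h where "h = min d \<delta> / 2"
    have "0 < h" "h < d" "h < \<delta>" using d(1) \<open>\<delta> > 0\<close> by (auto simp: h_def)
    with d(2)[of h] max_time[of "t\<^sub>0 + h"] show False by simp
  qed
  moreover have "trace (A ** H) \<le> 0"
    using sd(2) by (intro trace_mult_nonpos[OF A]) auto
  moreover have "g x\<^sub>0 = 0" by (rule sd(1))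
  ultimately show ?thesis by simp
qed

section \<open>Local defining functions of the degenerate boundary\<close>

lemma parallel_of_orthogonal_complement_subset:
  fixes N \<nu> :: "'a::real_inner"
  assumes "\<And>v. \<nu> \<bullet> v = 0 \<Longrightarrow> N \<bullet> v = 0" "\<nu> \<noteq> 0"
  shows "\<exists>k. N = k *\<^sub>R \<nu>"
proof -
  define k where "k = (\<nu> \<bullet> N) / (\<nu> \<bullet> \<nu>)"
  have "\<nu> \<bullet> (N - k *\<^sub>R \<nu>) = 0" using assms(2) by (simp add: k_def inner_diff_right)
  moreover from this have "N \<bullet> (N - k *\<^sub>R \<nu>) = 0" by (rule assms(1))
  ultimately have "(N - k *\<^sub>R \<nu>) \<bullet> (N - k *\<^sub>R \<nu>) = 0" by (simp add: inner_diff_left)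
  then show ?thesis by auto
qed

text \<open>Strict differentiability, the property of a \<open>C\<^sup>1\<close> function at a point that compares any two
  nearby points with each other and not only with the base point.\<close>
definition strict_gradient :: "('a::real_inner \<Rightarrow> real) \<Rightarrow> 'a \<Rightarrow> 'a \<Rightarrow> bool" where
  "strict_gradient F p N \<longleftrightarrow>
     (\<forall>\<epsilon>>0. \<exists>r>0. \<forall>x\<in>ball p r. \<forall>y\<in>ball p r. \<bar>F x - F y - N \<bullet> (x - y)\<bar> \<le> \<epsilon> * norm (x - y))"

lemma strict_gradient_obtains:
  assumes "strict_gradient F p N" "\<epsilon> > 0"
  obtains r where "r > 0"
    "\<And>x y. x \<in> ball p r \<Longrightarrow> y \<in> ball p r \<Longrightarrow> \<bar>F x - F y - N \<bullet> (x - y)\<bar> \<le> \<epsilon> * norm (x - y)"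
  using assms unfolding strict_gradient_def by blast

lemma dist_add_self: "dist p (p + v) = norm v" for p v :: "'a::real_normed_vector"
  by (simp add: dist_norm)

lemma continuous_within_dist_less:
  assumes "continuous (at x within S) f" "e > 0"
  shows "\<exists>d>0. \<forall>y\<in>S. dist y x < d \<longrightarrow> dist (f y) (f x) < e"
  using assms unfolding continuous_within_eps_delta by blast

text \<open>With \<open>\<pi>\<close> the projection along \<open>e\<close>, take \<open>F x = \<langle>e, x\<rangle> - f (\<pi> x)\<close>. It grows with slope 1 along \<open>e\<close>,
  which makes its gradient nonzero and its zero set the whole frontier near \<open>p\<close>.\<close>
lemma C1_holder_portion_level_set:
  fixes Q :: "'a::real_inner set"
  assumes "open Q" "0 < \<alpha>" "C1_holder_boundary_portion \<alpha> Q T" "p \<in> T"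
  obtains F N r where "r > 0" "N \<noteq> 0" "F p = 0" "continuous_on (ball p r) F" "strict_gradient F p N"
    "Q \<inter> ball p r = {x \<in> ball p r. 0 < F x}" "frontier Q \<inter> ball p r = {x \<in> ball p r. F x = 0}"
proof -
  have T: "T \<subseteq> frontier Q"
    using assms(3) unfolding C1_holder_boundary_portion_def by (rule conjunct1)
  have "\<exists>r>0. \<exists>e f. norm e = 1 \<and> C1_holder_on \<alpha> (ball (p - (e \<bullet> p) *\<^sub>R e) r) f \<and>
        Q \<inter> ball p r = {x \<in> ball p r. f (x - (e \<bullet> x) *\<^sub>R e) < e \<bullet> x}"
    using assms(3) unfolding C1_holder_boundary_portion_def by (blast intro: assms(4))
  then obtain r e f where r: "r > 0" and e: "norm e = 1"
    and holder: "C1_holder_on \<alpha> (ball (p - (e \<bullet> p) *\<^sub>R e) r) f"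
    and Q: "Q \<inter> ball p r = {x \<in> ball p r. f (x - (e \<bullet> x) *\<^sub>R e) < e \<bullet> x}"
    by (elim exE conjE)
  have ee: "e \<bullet> e = 1" using e by (simp add: norm_eq_1)
  define \<pi> where "\<pi> x = x - (e \<bullet> x) *\<^sub>R e" for x
  have \<pi>_diff: "\<pi> x - \<pi> y = \<pi> (x - y)" for x y by (simp add: \<pi>_def algebra_simps)
  have \<pi>_le: "norm (\<pi> x) \<le> norm x" for x
  proof -
    have "\<pi> x \<bullet> \<pi> x \<le> x \<bullet> x"
      by (simp add: \<pi>_def inner_diff_left inner_diff_right ee inner_commute)
    then show ?thesis by (simp add: norm_le)
  qed
  have \<pi>_adj: "\<pi> x \<bullet> y = \<pi> y \<bullet> x" for x y
    by (simp add: \<pi>_def inner_diff_left inner_commute[of y x])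
  have \<pi>_ball: "\<pi> x \<in> ball (\<pi> p) r" if "x \<in> ball p r" for x
    using that \<pi>_le[of "p - x"] by (simp add: dist_norm \<pi>_diff)
  from holder obtain g C where g: "\<And>x. x \<in> ball (\<pi> p) r \<Longrightarrow> GDERIV f x :> g x"
    and gC: "\<And>x y. x \<in> ball (\<pi> p) r \<Longrightarrow> y \<in> ball (\<pi> p) r \<Longrightarrow> norm (g x - g y) \<le> C * dist x y powr \<alpha>"
    unfolding C1_holder_on_def \<pi>_def by blast
  define F where "F x = e \<bullet> x - f (\<pi> x)" for x
  define G where "G x = e - \<pi> (g (\<pi> x))" for x
  have deriv: "(F has_derivative (\<lambda>h. G x \<bullet> h)) (at x)" if "x \<in> ball p r" for x
  proof -
    have "(\<pi> has_derivative \<pi>) (at x)"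
      unfolding \<pi>_def by (auto intro!: derivative_eq_intros)
    moreover have "(f has_derivative (\<lambda>h. h \<bullet> g (\<pi> x))) (at (\<pi> x))"
      using g[OF \<pi>_ball[OF that]] by (simp add: gderiv_def)
    ultimately have "((\<lambda>x. f (\<pi> x)) has_derivative (\<lambda>h. \<pi> h \<bullet> g (\<pi> x))) (at x)"
      by (rule has_derivative_compose)
    then show ?thesis
      unfolding F_def
      by (auto intro!: derivative_eq_intros simp: G_def inner_diff_left \<pi>_adj)
  qed
  have cont: "continuous_on (ball p r) F"
    using deriv has_derivative_continuous by (intro continuous_at_imp_continuous_on) blast
  have G_p: "G p \<bullet> e = 1"
    by (simp add: G_def inner_diff_left \<pi>_adj ee) (simp add: \<pi>_def ee)
  have strict: "strict_gradient F p (G p)"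
    unfolding strict_gradient_def
  proof (intro allI impI)
    fix \<epsilon> :: real assume "\<epsilon> > 0"
    \<comment> \<open>within distance \<open>\<eta>\<close> the Hoelder bound bounds the change of the gradient by \<open>\<epsilon>\<close>\<close>
    define \<eta> where "\<eta> = (\<epsilon> / (\<bar>C\<bar> + 1)) powr (1 / \<alpha>)"
    have \<eta>: "\<eta> > 0" "\<eta> powr \<alpha> = \<epsilon> / (\<bar>C\<bar> + 1)"
      using \<open>\<epsilon> > 0\<close> \<open>0 < \<alpha>\<close> by (simp_all add: \<eta>_def powr_powr add_nonneg_pos)
    define \<rho> where "\<rho> = min r \<eta>"
    have "\<rho> > 0" using r \<eta>(1) by (simp add: \<rho>_def)
    have G_close: "norm (G x - G p) \<le> \<epsilon>" if "x \<in> ball p \<rho>" for x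
    proof -
      have x: "x \<in> ball p r" using that by (simp add: \<rho>_def)
      have "G x - G p = - \<pi> (g (\<pi> x) - g (\<pi> p))" by (simp add: G_def flip: \<pi>_diff)
      then have "norm (G x - G p) \<le> norm (g (\<pi> x) - g (\<pi> p))" using \<pi>_le by simp
      also have "\<dots> \<le> C * dist (\<pi> x) (\<pi> p) powr \<alpha>"
        using \<pi>_ball[OF x] r by (intro gC) auto
      also have "\<dots> \<le> (\<bar>C\<bar> + 1) * \<eta> powr \<alpha>"
      proof (intro mult_mono powr_mono2)
        show "dist (\<pi> x) (\<pi> p) \<le> \<eta>"
          using that \<pi>_le[of "x - p"] by (simp add: dist_norm \<pi>_diff \<rho>_def norm_minus_commute)
      qed (use \<open>0 < \<alpha>\<close> in auto)
      also have "\<dots> = \<epsilon>" unfolding \<eta>(2) by (simp add: add_nonneg_pos)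
      finally show ?thesis .
    qed
    have "\<bar>F x - F y - G p \<bullet> (x - y)\<bar> \<le> \<epsilon> * norm (x - y)" if "x \<in> ball p \<rho>" "y \<in> ball p \<rho>" for x y
    proof -
      have "norm ((F x - G p \<bullet> x) - (F y - G p \<bullet> y)) \<le> \<epsilon> * norm (x - y)"
      proof (rule differentiable_bound[OF convex_ball _ _ that])
        fix z assume z: "z \<in> ball p \<rho>"
        then have "z \<in> ball p r" by (simp add: \<rho>_def)
        then have "((\<lambda>x. F x - G p \<bullet> x) has_derivative (\<lambda>h. (G z - G p) \<bullet> h)) (at z)"
          by (auto intro!: derivative_eq_intros deriv simp: inner_diff_left)
        then show "((\<lambda>x. F x - G p \<bullet> x) has_derivative (\<lambda>h. (G z - G p) \<bullet> h)) (at z within ball p \<rho>)"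
          by (rule has_derivative_at_withinI)
        show "onorm (\<lambda>h. (G z - G p) \<bullet> h) \<le> \<epsilon>"
        proof (rule onorm_bound)
          fix h
          show "norm ((G z - G p) \<bullet> h) \<le> \<epsilon> * norm h"
            using Cauchy_Schwarz_ineq2[of "G z - G p" h] mult_right_mono[OF G_close[OF z], of "norm h"] by simp
        qed (use \<open>\<epsilon> > 0\<close> in simp)
      qed
      then show ?thesis by (simp add: inner_diff_right algebra_simps)
    qed
    with \<open>\<rho> > 0\<close> show "\<exists>r>0. \<forall>x\<in>ball p r. \<forall>y\<in>ball p r. \<bar>F x - F y - G p \<bullet> (x - y)\<bar> \<le> \<epsilon> * norm (x - y)"
      by blast
  qed
  have QF: "Q \<inter> ball p r = {x \<in> ball p r. 0 < F x}"
    using Q by (simp add: F_def \<pi>_def)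
  have F_e: "F (x + s *\<^sub>R e) = F x + s" for x s
    by (simp add: F_def \<pi>_def inner_add_right ee algebra_simps)
  have front: "x \<in> frontier Q \<longleftrightarrow> F x = 0" if x: "x \<in> ball p r" for x
  proof
    assume fr: "x \<in> frontier Q"
    then have "x \<notin> Q" using \<open>open Q\<close> by (simp add: frontier_def interior_open)
    then have "F x \<le> 0" using QF x by force
    moreover have "\<not> F x < 0"
    proof
      assume "F x < 0"
      have "open {y \<in> ball p r. F y < 0}"
        using cont open_ball continuous_on_open_vimage[of "ball p r" F]
        by (auto simp: vimage_def Int_def conj_commute dest!: spec[of _ "{..<0}"])
      moreover have "x \<in> {y \<in> ball p r. F y < 0}" using x \<open>F x < 0\<close> by simp
      moreover have "x \<in> closure Q" using fr by (simp add: frontier_def)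
      ultimately obtain y where "y \<in> Q" "y \<in> ball p r" "F y < 0"
        by (metis (no_types, lifting) closure_iff_nhds_not_empty mem_Collect_eq Int_emptyI subset_refl)
      then show False using QF by force
    qed
    ultimately show "F x = 0" by simp
  next
    assume "F x = 0"
    then have "x \<notin> Q" using QF x by force
    moreover have "x \<in> closure Q"
      unfolding closure_approachable
    proof (intro allI impI)
      fix \<epsilon> :: real assume "\<epsilon> > 0"
      define s where "s = min \<epsilon> (r - dist p x) / 2"
      have s: "0 < s" "s < \<epsilon>" "s < r - dist p x" using \<open>\<epsilon> > 0\<close> x by (auto simp: s_def)
      have d: "dist x (x + s *\<^sub>R e) = s" using s e by (simp add: dist_norm)
      then have "x + s *\<^sub>R e \<in> ball p r"
        using s(3) dist_triangle[of p "x + s *\<^sub>R e" x] by simp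
      moreover have "0 < F (x + s *\<^sub>R e)" using F_e[of x s] \<open>F x = 0\<close> s by simp
      ultimately have "x + s *\<^sub>R e \<in> Q" using QF by blast
      then show "\<exists>y\<in>Q. dist y x < \<epsilon>" using d s by (metis dist_commute)
    qed
    ultimately show "x \<in> frontier Q" using \<open>open Q\<close> by (simp add: frontier_def interior_open)
  qed
  show thesis
  proof
    show "G p \<noteq> 0" using G_p by auto
    show "F p = 0" using front[of p] r T assms(4) by auto
    show "frontier Q \<inter> ball p r = {x \<in> ball p r. F x = 0}" using front by blast
  qed (use r cont strict QF in auto)
qed

lemma strict_gradient_vanishes_on_tangent_cone:
  fixes F :: "'a::real_inner \<Rightarrow> real"
  assumes strict: "strict_gradient F p N" and v: "v \<in> tangent_cone S p"
    and "r > 0" and level: "\<And>x. x \<in> S \<Longrightarrow> x \<in> ball p r \<Longrightarrow> F x = F p"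
  shows "N \<bullet> v = 0"
proof -
  from v obtain s w where s: "\<And>k::nat. 0 < s k" and sw: "\<And>k. p + s k *\<^sub>R w k \<in> S"
    and lim: "s \<longlonglongrightarrow> 0" "w \<longlonglongrightarrow> v"
    unfolding tangent_cone_def by auto
  have bound: "\<bar>N \<bullet> v\<bar> \<le> \<epsilon> * norm v" if "\<epsilon> > 0" for \<epsilon>
  proof -
    obtain \<rho> where \<rho>: "\<rho> > 0" "\<And>x y. x \<in> ball p \<rho> \<Longrightarrow> y \<in> ball p \<rho> \<Longrightarrow> \<bar>F x - F y - N \<bullet> (x - y)\<bar> \<le> \<epsilon> * norm (x - y)"
      using strict \<open>\<epsilon> > 0\<close> unfolding strict_gradient_def by meson
    have "(\<lambda>k. p + s k *\<^sub>R w k) \<longlonglongrightarrow> p + 0 *\<^sub>R v" by (intro tendsto_intros lim)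
    then have "\<forall>\<^sub>F k in sequentially. p + s k *\<^sub>R w k \<in> ball p (min r \<rho>)"
      using \<open>r > 0\<close> \<rho>(1) by (intro topological_tendstoD) auto
    then have "\<forall>\<^sub>F k in sequentially. \<bar>N \<bullet> w k\<bar> \<le> \<epsilon> * norm (w k)"
    proof eventually_elim
      case (elim k)
      then have "\<bar>F (p + s k *\<^sub>R w k) - F p - N \<bullet> (p + s k *\<^sub>R w k - p)\<bar> \<le> \<epsilon> * norm (p + s k *\<^sub>R w k - p)"
        using \<rho>(1) by (intro \<rho>(2)) auto
      moreover have "F (p + s k *\<^sub>R w k) = F p" using elim sw by (intro level) auto
      ultimately have "s k * \<bar>N \<bullet> w k\<bar> \<le> s k * (\<epsilon> * norm (w k))"
        using s[of k] by (simp add: abs_mult mult_ac)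
      then show ?case using s[of k] by simp
    qed
    then show ?thesis
      by (rule tendsto_le[OF sequentially_bot, rotated 2]) (intro tendsto_intros lim)+
  qed
  have "\<bar>N \<bullet> v\<bar> \<le> 0 * norm v"
  proof (rule tendsto_le[where F = "at_right (0::real)"])
    show "((\<lambda>\<epsilon>. \<epsilon> * norm v) \<longlongrightarrow> 0 * norm v) (at_right 0)" by (intro tendsto_intros)
    show "\<forall>\<^sub>F \<epsilon> in at_right 0. \<bar>N \<bullet> v\<bar> \<le> \<epsilon> * norm v"
      using bound by (auto simp: eventually_at_right_less intro: eventually_mono[OF eventually_at_right_less])
  qed auto
  then show ?thesis by simp
qed

text \<open>The tangent cone of the frontier is a hyperplane with purely spatial normal, and the gradient of a
  local defining function vanishes on it; so the gradient is parallel to that normal and has no time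
  component. Its sign is fixed because \<open>Q\<close> is the side where the defining function is positive. This
  determines the inward normal uniquely.\<close>
lemma degenerate_boundary_level_set:
  fixes Q :: "(real \<times> (real^'n)) set"
  assumes "open Q" "0 < \<alpha>" "C1_holder_boundary_portion \<alpha> Q (degenerate_boundary Q a)"
    and P: "P \<in> degenerate_boundary Q a"
  obtains F m R where "R > 0" "m \<noteq> 0" "inward_normal Q P = (1 / norm m) *\<^sub>R m" "F P = 0"
    "continuous_on (ball P R) F" "strict_gradient F P (0, m)"
    "Q \<inter> ball P R = {X \<in> ball P R. 0 < F X}"
    "degenerate_boundary Q a \<inter> ball P R = {X \<in> ball P R. F X = 0}"
proof -
  obtain F N r where r: "r > 0" and "N \<noteq> 0" "F P = 0" and cont: "continuous_on (ball P r) F"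
    and strict: "strict_gradient F P N"
    and Q: "Q \<inter> ball P r = {x \<in> ball P r. 0 < F x}"
    and fr: "frontier Q \<inter> ball P r = {x \<in> ball P r. F x = 0}"
    by (rule C1_holder_portion_level_set[OF assms])
  have Q_iff: "X \<in> Q \<longleftrightarrow> 0 < F X" if "X \<in> ball P r" for X
  proof -
    have "X \<in> Q \<inter> ball P r \<longleftrightarrow> X \<in> {x \<in> ball P r. 0 < F x}" by (simp only: Q)
    then show ?thesis using that by simp
  qed
  have frontier_iff: "X \<in> frontier Q \<longleftrightarrow> F X = 0" if "X \<in> ball P r" for X
  proof -
    have "X \<in> frontier Q \<inter> ball P r \<longleftrightarrow> X \<in> {x \<in> ball P r. F x = 0}" by (simp only: fr)
    then show ?thesis using that by simp
  qed
  have "openin (top_of_set (frontier Q)) (degenerate_boundary Q a)"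
    unfolding degenerate_boundary_def by (intro openin_Int openin_interior_of)
  then obtain T where T: "open T" "degenerate_boundary Q a = frontier Q \<inter> T"
    by (meson openin_open)
  then obtain r' where r': "r' > 0" "ball P r' \<subseteq> T"
    using P by (metis IntE open_contains_ball)
  have "P \<in> {P \<in> frontier Q. \<exists>n. tangent_hyperplane_with_normal (frontier Q) P (0, n)}"
    using P interior_of_subset unfolding degenerate_boundary_def by fastforce
  then obtain n where n: "tangent_hyperplane_with_normal (frontier Q) P (0, n)" by blast
  have par: "\<exists>k. k \<noteq> 0 \<and> N = k *\<^sub>R (0, n')"
    if "tangent_hyperplane_with_normal (frontier Q) P (0, n')" for n'
  proof -
    have "N \<bullet> v = 0" if "(0, n') \<bullet> v = 0" for v
    proof (rule strict_gradient_vanishes_on_tangent_cone[OF strict _ r])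
      show "v \<in> tangent_cone (frontier Q) P"
        using that \<open>tangent_hyperplane_with_normal (frontier Q) P (0, n')\<close>
        by (simp add: tangent_hyperplane_with_normal_def)
      show "F x = F P" if "x \<in> frontier Q" "x \<in> ball P r" for x
        using that frontier_iff \<open>F P = 0\<close> by simp
    qed
    moreover have "(0::real, n') \<noteq> 0" using that by (simp add: tangent_hyperplane_with_normal_def)
    ultimately obtain k where "N = k *\<^sub>R (0, n')"
      using parallel_of_orthogonal_complement_subset[of "(0, n')" N] by blast
    moreover from this have "k \<noteq> 0" using \<open>N \<noteq> 0\<close> by (auto simp: zero_prod_def)
    ultimately show ?thesis by blast
  qed
  define m where "m = snd N"
  obtain k where k: "k \<noteq> 0" "N = k *\<^sub>R (0, n)" using par[OF n] by blast
  have N: "N = (0, m)" by (simp add: k(2) m_def)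
  have "m \<noteq> 0" using \<open>N \<noteq> 0\<close> N by (auto simp: zero_prod_def)
  obtain \<rho> where \<rho>: "\<rho> > 0" "\<And>x y. x \<in> ball P \<rho> \<Longrightarrow> y \<in> ball P \<rho> \<Longrightarrow>
      \<bar>F x - F y - N \<bullet> (x - y)\<bar> \<le> (norm m / 2) * norm (x - y)"
    using strict \<open>m \<noteq> 0\<close> unfolding strict_gradient_def by (meson half_gt_zero zero_less_norm_iff)
  have F_line: "\<bar>F (P + s *\<^sub>R (0, n')) - s * (m \<bullet> n')\<bar> \<le> (norm m / 2) * s"
    "P + s *\<^sub>R (0, n') \<in> ball P r"
    if "norm n' = 1" "0 < s" "s < min r \<rho>" for s n'
  proof -
    have "P + s *\<^sub>R (0, n') \<in> ball P \<rho>" "P + s *\<^sub>R (0, n') \<in> ball P r"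
      using that by (auto simp: dist_norm norm_Pair)
    then show "\<bar>F (P + s *\<^sub>R (0, n')) - s * (m \<bullet> n')\<bar> \<le> (norm m / 2) * s"
        "P + s *\<^sub>R (0, n') \<in> ball P r"
      using \<rho>(2)[of "P + s *\<^sub>R (0, n')" P] \<rho>(1) \<open>F P = 0\<close> that by (auto simp: N norm_Pair)
  qed
  have "inward_normal Q P = (1 / norm m) *\<^sub>R m"
    unfolding inward_normal_def
  proof (rule the_equality)
    define n\<^sub>0 where "n\<^sub>0 = (1 / norm m) *\<^sub>R m"
    have n0: "norm n\<^sub>0 = 1" "m \<bullet> n\<^sub>0 = norm m"
      using \<open>m \<noteq> 0\<close> by (auto simp: n\<^sub>0_def dot_square_norm power2_eq_square)
    have "tangent_hyperplane_with_normal (frontier Q) P (0, n\<^sub>0)"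
    proof -
      have "m = k *\<^sub>R n" by (simp add: m_def k(2))
      then have "{v. (0::real, n\<^sub>0) \<bullet> v = 0} = {v. (0, n) \<bullet> v = 0}"
        using k(1) \<open>m \<noteq> 0\<close> by (auto simp: n\<^sub>0_def inner_prod_def)
      then show ?thesis using n n0 unfolding tangent_hyperplane_with_normal_def
        by (auto simp: zero_prod_def)
    qed
    moreover have "P + s *\<^sub>R (0, n\<^sub>0) \<in> Q" if "0 < s" "s < min r \<rho>" for s
    proof -
      have "0 < s * norm m - (norm m / 2) * s" using \<open>m \<noteq> 0\<close> that by simp
      also have "\<dots> \<le> F (P + s *\<^sub>R (0, n\<^sub>0))"
        using abs_le_D2[OF F_line(1)[OF n0(1) that]] n0(2) by (simp add: algebra_simps)
      finally show ?thesis using Q_iff[OF F_line(2)[OF n0(1) that]] by simp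
    qed
    moreover have "min r \<rho> > 0" using r \<rho>(1) by simp
    ultimately show "norm ((1 / norm m) *\<^sub>R m) = 1 \<and>
      tangent_hyperplane_with_normal (frontier Q) P (0, (1 / norm m) *\<^sub>R m) \<and>
      (\<exists>\<delta>>0. \<forall>s. 0 < s \<and> s < \<delta> \<longrightarrow> P + s *\<^sub>R (0, (1 / norm m) *\<^sub>R m) \<in> Q)"
      using n0(1) unfolding n\<^sub>0_def by blast
  next
    fix n' assume *: "norm n' = 1 \<and> tangent_hyperplane_with_normal (frontier Q) P (0, n') \<and>
      (\<exists>\<delta>>0. \<forall>s. 0 < s \<and> s < \<delta> \<longrightarrow> P + s *\<^sub>R (0, n') \<in> Q)"
    then obtain \<delta> where \<delta>: "\<delta> > 0" "\<And>s. 0 < s \<Longrightarrow> s < \<delta> \<Longrightarrow> P + s *\<^sub>R (0, n') \<in> Q" by blast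
    obtain k' where "k' \<noteq> 0" "N = k' *\<^sub>R (0, n')" using par * by blast
    then have k': "m = k' *\<^sub>R n'" by (simp add: m_def)
    then have norm_m: "norm m = \<bar>k'\<bar>" "m \<bullet> n' = k'" using * by (auto simp: dot_square_norm)
    have "k' > 0"
    proof (rule ccontr)
      assume "\<not> k' > 0"
      then have "k' < 0" using \<open>k' \<noteq> 0\<close> by simp
      define s where "s = min (min r \<rho>) \<delta> / 2"
      have s: "0 < s" "s < min r \<rho>" "s < \<delta>" using r \<rho>(1) \<delta>(1) by (auto simp: s_def)
      have "F (P + s *\<^sub>R (0, n')) > 0"
        using \<delta>(2)[OF s(1,3)] Q_iff[OF F_line(2)[of n' s]] * s by blast
      moreover have "F (P + s *\<^sub>R (0, n')) \<le> s * k' - k' / 2 * s"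
        using abs_le_D1[OF F_line(1)[of n' s]] * s norm_m \<open>k' < 0\<close> by (simp add: algebra_simps)
      moreover have "s * k' - k' / 2 * s < 0" using s(1) \<open>k' < 0\<close> by (simp add: mult_neg_pos)
      ultimately show False by linarith
    qed
    then show "n' = (1 / norm m) *\<^sub>R m" using norm_m(1) k' by simp
  qed
  moreover have "min r r' > 0" using r r' by simp
  moreover have "continuous_on (ball P (min r r')) F"
    using cont by (rule continuous_on_subset) auto
  moreover have "Q \<inter> ball P (min r r') = {x \<in> ball P (min r r'). 0 < F x}"
    using Q_iff by (intro set_eqI) auto
  moreover have "degenerate_boundary Q a \<inter> ball P (min r r') = {x \<in> ball P (min r r'). F x = 0}"
    using frontier_iff r'(2) unfolding T(2) by (intro set_eqI) auto
  moreover have "strict_gradient F P (0, m)" using strict N by simp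
  ultimately show thesis
    using \<open>m \<noteq> 0\<close> \<open>F P = 0\<close> by (intro that[of "min r r'" m F])
qed

section \<open>Comparison with strict subsolutions in the interior\<close>

text \<open>The inequality is required only where \<open>u \<ge> 0\<close>; there it follows from \<open>Lu \<le> 0\<close> and \<open>c \<ge> 0\<close>.\<close>
locale positive_subsolution =
  fixes Q :: "(real \<times> (real^'n)) set"
    and a :: "real \<times> (real^'n) \<Rightarrow> real^'n^'n"
    and b :: "real \<times> (real^'n) \<Rightarrow> real^'n"
    and u ut :: "real \<times> (real^'n) \<Rightarrow> real"
    and Du :: "real \<times> (real^'n) \<Rightarrow> real^'n"
    and D2u :: "real \<times> (real^'n) \<Rightarrow> real^'n^'n"
  assumes open_Q: "open Q"
    and a_psd: "P \<in> Q \<Longrightarrow> nonneg_definite_symmetric (a P)"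
    and u_time: "P \<in> Q \<Longrightarrow> ((\<lambda>t. u (t, snd P)) has_real_derivative ut P) (at (fst P))"
    and u_space: "P \<in> Q \<Longrightarrow> GDERIV (\<lambda>x. u (fst P, x)) (snd P) :> Du P"
    and u_hess: "P \<in> Q \<Longrightarrow> ((\<lambda>x. Du (fst P, x)) has_derivative (\<lambda>h. D2u P *v h)) (at (snd P))"
    and subsol: "P \<in> Q \<Longrightarrow> 0 \<le> u P \<Longrightarrow> 0 \<le> ut P + trace (a P ** D2u P) + b P \<bullet> Du P"
begin

text \<open>At such a maximum the parabolic expression of \<open>u + \<epsilon> w\<close> would be nonpositive, but it is the sum of a
  nonnegative and a positive number.\<close>
lemma no_interior_max:
  fixes w :: "real \<times> (real^'n) \<Rightarrow> real"
  assumes P: "(t\<^sub>0, x\<^sub>0) \<in> Q" and u_nonneg: "0 \<le> u (t\<^sub>0, x\<^sub>0)" and "\<epsilon> > 0"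
    and w_time: "((\<lambda>t. w (t, x\<^sub>0)) has_real_derivative wt) (at t\<^sub>0)"
    and w_space: "\<And>x. GDERIV (\<lambda>x. w (t\<^sub>0, x)) x :> Dw x"
    and w_hess: "(Dw has_derivative (\<lambda>h. D2w *v h)) (at x\<^sub>0)"
    and w_strict: "0 < wt + trace (a (t\<^sub>0, x\<^sub>0) ** D2w) + b (t\<^sub>0, x\<^sub>0) \<bullet> Dw x\<^sub>0"
    and "\<delta> > 0"
    and max: "\<And>t x. (t, x) \<in> ball (t\<^sub>0, x\<^sub>0) \<delta> \<Longrightarrow> t\<^sub>0 \<le> t \<Longrightarrow>
      u (t, x) + \<epsilon> * w (t, x) \<le> u (t\<^sub>0, x\<^sub>0) + \<epsilon> * w (t\<^sub>0, x\<^sub>0)"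
  shows False
proof -
  obtain \<rho> where \<rho>: "\<rho> > 0" "ball (t\<^sub>0, x\<^sub>0) \<rho> \<subseteq> Q"
    using open_Q P by (meson open_contains_ball)
  define d where "d = min \<delta> \<rho>"
  have d: "d > 0" "d \<le> \<delta>" "d \<le> \<rho>" using \<rho>(1) \<open>\<delta> > 0\<close> by (auto simp: d_def)
  have slice: "(t\<^sub>0, x) \<in> ball (t\<^sub>0, x\<^sub>0) \<delta>" "(t\<^sub>0, x) \<in> Q" if "x \<in> ball x\<^sub>0 d" for x
    using that d \<rho>(2) by (auto simp: dist_Pair_Pair subset_iff)
  have "(ut (t\<^sub>0, x\<^sub>0) + \<epsilon> * wt) + trace (a (t\<^sub>0, x\<^sub>0) ** (D2u (t\<^sub>0, x\<^sub>0) + \<epsilon> *\<^sub>R D2w))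
      + b (t\<^sub>0, x\<^sub>0) \<bullet> (Du (t\<^sub>0, x\<^sub>0) + \<epsilon> *\<^sub>R Dw x\<^sub>0) \<le> 0"
  proof (rule parabolic_expr_nonpos_at_max[where y = "\<lambda>P. u P + \<epsilon> * w P" and x\<^sub>0 = x\<^sub>0 and t\<^sub>0 = t\<^sub>0
        and g = "\<lambda>x. Du (t\<^sub>0, x) + \<epsilon> *\<^sub>R Dw x"])
    show "((\<lambda>t. u (t, x\<^sub>0) + \<epsilon> * w (t, x\<^sub>0)) has_real_derivative ut (t\<^sub>0, x\<^sub>0) + \<epsilon> * wt) (at t\<^sub>0)"
      using u_time[OF P] w_time by (auto intro!: derivative_eq_intros)
    show "GDERIV (\<lambda>x. u (t\<^sub>0, x) + \<epsilon> * w (t\<^sub>0, x)) x :> Du (t\<^sub>0, x) + \<epsilon> *\<^sub>R Dw x"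
      if "x \<in> ball x\<^sub>0 d" for x
      using u_space[OF slice(2)[OF that]] w_space[of x] unfolding gderiv_def
      by (auto intro!: derivative_eq_intros simp: inner_add_right)
    show "((\<lambda>x. Du (t\<^sub>0, x) + \<epsilon> *\<^sub>R Dw x) has_derivative
        (\<lambda>h. (D2u (t\<^sub>0, x\<^sub>0) + \<epsilon> *\<^sub>R D2w) *v h)) (at x\<^sub>0)"
      using u_hess[OF P] w_hess
      by (auto intro!: derivative_eq_intros simp: matrix_vector_mult_add_rdistrib
          simp flip: scaleR_matrix_vector_assoc)
    show "u (t, x\<^sub>0) + \<epsilon> * w (t, x\<^sub>0) \<le> u (t\<^sub>0, x\<^sub>0) + \<epsilon> * w (t\<^sub>0, x\<^sub>0)" if "t\<^sub>0 < t" "t < t\<^sub>0 + d" for t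
      using that d by (intro max) (auto simp: dist_Pair_Pair dist_real_def)
    show "u (t\<^sub>0, x) + \<epsilon> * w (t\<^sub>0, x) \<le> u (t\<^sub>0, x\<^sub>0) + \<epsilon> * w (t\<^sub>0, x\<^sub>0)" if "x \<in> ball x\<^sub>0 d" for x
      using slice(1)[OF that] by (intro max) auto
  qed (use a_psd[OF P] d in auto)
  then have "(ut (t\<^sub>0, x\<^sub>0) + trace (a (t\<^sub>0, x\<^sub>0) ** D2u (t\<^sub>0, x\<^sub>0)) + b (t\<^sub>0, x\<^sub>0) \<bullet> Du (t\<^sub>0, x\<^sub>0))
     + \<epsilon> * (wt + trace (a (t\<^sub>0, x\<^sub>0) ** D2w) + b (t\<^sub>0, x\<^sub>0) \<bullet> Dw x\<^sub>0) \<le> 0"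
    by (simp add: matrix_add_ldistrib trace_add trace_scaleR matrix_mult_scaleR_right inner_add_right
        algebra_simps)
  moreover have "\<epsilon> * (wt + trace (a (t\<^sub>0, x\<^sub>0) ** D2w) + b (t\<^sub>0, x\<^sub>0) \<bullet> Dw x\<^sub>0) > 0"
    using \<open>\<epsilon> > 0\<close> w_strict by simp
  ultimately show False using subsol[OF P u_nonneg] by linarith
qed

end

lemma has_derivative_inner_self_diff:
  "((\<lambda>x. (x - c) \<bullet> (x - c)) has_derivative (\<lambda>h. 2 * ((x - c) \<bullet> h))) (at x)"
  for x c :: "'a::real_inner"
  by (auto intro!: derivative_eq_intros simp: inner_commute)

text \<open>This and the next two lemmas differentiate the tube barrier, a multiple of \<open>(d - \<bar>x - c\<bar>\<^sup>2)\<^sup>2\<close> whose centre \<open>c\<close>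
  moves with constant velocity \<open>V\<close>.\<close>
lemma gderiv_bump:
  "GDERIV (\<lambda>x. E * (d - (x - c) \<bullet> (x - c))\<^sup>2) x :> (- 4 * E * (d - (x - c) \<bullet> (x - c))) *\<^sub>R (x - c)"
  unfolding gderiv_def
  by (rule derivative_eq_intros has_derivative_inner_self_diff refl)+
    (simp add: fun_eq_iff inner_commute power2_eq_square)

lemma bump_hessian:
  fixes x c :: "real^'n"
  shows "((\<lambda>x. (- 4 * E * (d - (x - c) \<bullet> (x - c))) *\<^sub>R (x - c)) has_derivative
    (\<lambda>h. (E *\<^sub>R (8 *\<^sub>R outer (x - c) (x - c) - (4 * (d - (x - c) \<bullet> (x - c))) *\<^sub>R mat 1)) *v h)) (at x)"
proof -
  have *: "(E *\<^sub>R (8 *\<^sub>R outer y y - (4 * s) *\<^sub>R mat 1)) *v h = 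
    (- 4 * E * s) *\<^sub>R h + (8 * E * (y \<bullet> h)) *\<^sub>R y" for y h :: "real^'n" and s
    by (simp add: outer_mult_vec matrix_vector_mult_diff_rdistrib scaleR_diff_right mult_ac
      flip: scaleR_matrix_vector_assoc)
  show ?thesis
    unfolding *
    by (rule derivative_eq_intros has_derivative_inner_self_diff refl)+
      (simp add: fun_eq_iff)
qed

lemma bump_time_deriv:
  fixes x\<^sub>3 V x :: "'a::real_inner" and t\<^sub>3 d \<kappa> :: real
  defines "c \<equiv> \<lambda>t. x\<^sub>3 + (t - t\<^sub>3) *\<^sub>R V"
  shows "((\<lambda>t. exp (\<kappa> * (t - t\<^sub>3)) * (d - (x - c t) \<bullet> (x - c t))\<^sup>2) has_real_derivative
    exp (\<kappa> * (t - t\<^sub>3)) * (\<kappa> * (d - (x - c t) \<bullet> (x - c t))\<^sup>2 + 4 * (d - (x - c t) \<bullet> (x - c t)) * ((x - c t) \<bullet> V))) (at t)"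
proof -
  have "((\<lambda>t. x - c t) has_vector_derivative - V) (at t)"
    unfolding c_def by (auto intro!: derivative_eq_intros)
  then have "((\<lambda>t. x - c t) has_derivative (\<lambda>h. h *\<^sub>R - V)) (at t)"
    by (simp add: has_vector_derivative_def)
  from has_derivative_inner[OF this this]
  have *: "((\<lambda>t. (x - c t) \<bullet> (x - c t)) has_real_derivative - 2 * ((x - c t) \<bullet> V)) (at t)"
    unfolding has_field_derivative_def
    by (rule has_derivative_eq_rhs) (simp add: fun_eq_iff inner_commute)
  show ?thesis
    by (rule derivative_eq_intros * refl)+ (simp add: power2_eq_square algebra_simps)
qed

section \<open>Propagation of the maximum forward in time\<close>

text \<open>The discriminant is negative for this choice of the leading coefficient.\<close>
lemma quadratic_pos_of_large_leading_coeff: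
  fixes p C s :: real
  assumes "p > 0" "C > 0"
  shows "0 < (C\<^sup>2 / (2 * p)) * s\<^sup>2 - C * s + p"
proof -
  have "(C\<^sup>2 / (2 * p)) * s\<^sup>2 - C * s + p = ((C * s - p)\<^sup>2 + p\<^sup>2) / (2 * p)"
    using assms by (simp add: field_simps power2_eq_square)
  also have "\<dots> > 0" using assms by (intro divide_pos_pos add_nonneg_pos) auto
  finally show ?thesis .
qed

context positive_subsolution
begin

text \<open>The barrier argument in a tube around the segment from \<open>(t\<^sub>1, x\<^sub>1)\<close> to \<open>(t\<^sub>3, x\<^sub>3)\<close>. The tube stays inside the
  ball because its axis is less than \<open>R / 2\<close> away from the centre and its radius is less than \<open>R / 2\<close>.\<close>
lemma max_propagates_forward_in_ball:
  assumes u_cont: "continuous_on Q u" and u_le: "\<And>P. P \<in> Q \<Longrightarrow> u P \<le> M"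
    and ball: "ball (t\<^sub>1, x\<^sub>1) R \<subseteq> Q" and "\<theta> > 0"
    and ellip: "\<And>P v. P \<in> ball (t\<^sub>1, x\<^sub>1) R \<Longrightarrow> \<theta> * (v \<bullet> v) \<le> v \<bullet> (a P *v v)"
    and a_bd: "\<And>P. P \<in> ball (t\<^sub>1, x\<^sub>1) R \<Longrightarrow> trace (a P) \<le> \<Lambda>"
    and b_bd: "\<And>P. P \<in> ball (t\<^sub>1, x\<^sub>1) R \<Longrightarrow> norm (b P) \<le> B"
    and u_nonneg: "\<And>P. P \<in> ball (t\<^sub>1, x\<^sub>1) R \<Longrightarrow> 0 \<le> u P"
    and P1: "u (t\<^sub>1, x\<^sub>1) = M"
    and P3: "(t\<^sub>3, x\<^sub>3) \<in> ball (t\<^sub>1, x\<^sub>1) (R / 2)" and "t\<^sub>1 < t\<^sub>3"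
  shows "u (t\<^sub>3, x\<^sub>3) = M"
proof (rule ccontr)
  assume "u (t\<^sub>3, x\<^sub>3) \<noteq> M"
  have "R / 2 > 0" using P3 by (metis ball_eq_empty empty_iff not_le)
  then have "R > 0" by simp
  have P3Q: "(t\<^sub>3, x\<^sub>3) \<in> Q" using P3 \<open>R > 0\<close> ball by (force simp: subset_iff)
  define m where "m = (M - u (t\<^sub>3, x\<^sub>3)) / 2"
  have "m > 0" using u_le[OF P3Q] \<open>u (t\<^sub>3, x\<^sub>3) \<noteq> M\<close> by (simp add: m_def)
  have "continuous (at (t\<^sub>3, x\<^sub>3)) u"
    using u_cont P3Q open_Q continuous_on_eq_continuous_at by blast
  then obtain \<delta>\<^sub>0 where \<delta>0: "\<delta>\<^sub>0 > 0" "\<And>P. dist P (t\<^sub>3, x\<^sub>3) < \<delta>\<^sub>0 \<Longrightarrow> dist (u P) (u (t\<^sub>3, x\<^sub>3)) < m"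
    unfolding continuous_at_eps_delta using \<open>m > 0\<close> by meson
  define \<delta> where "\<delta> = min \<delta>\<^sub>0 (R / 2) / 2"
  have \<delta>: "\<delta> > 0" "\<delta> < \<delta>\<^sub>0" "\<delta> < R / 2" using \<delta>0(1) \<open>R > 0\<close> by (auto simp: \<delta>_def)
  have top: "u (t\<^sub>3, x) \<le> M - m" if "dist x x\<^sub>3 \<le> \<delta>" for x
  proof -
    have "dist (u (t\<^sub>3, x)) (u (t\<^sub>3, x\<^sub>3)) < m"
      using that \<delta>(2) by (intro \<delta>0(2)) (simp add: dist_Pair_Pair)
    then show ?thesis unfolding dist_real_def m_def by argo
  qed
  define V where "V = (1 / (t\<^sub>3 - t\<^sub>1)) *\<^sub>R (x\<^sub>3 - x\<^sub>1)"
  define c where "c t = x\<^sub>3 + (t - t\<^sub>3) *\<^sub>R V" for t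
  have c3: "c t\<^sub>3 = x\<^sub>3" by (simp add: c_def)
  have c1: "c t\<^sub>1 = x\<^sub>1"
  proof -
    have "(t\<^sub>3 - t\<^sub>1) *\<^sub>R V = x\<^sub>3 - x\<^sub>1" using \<open>t\<^sub>1 < t\<^sub>3\<close> by (simp add: V_def)
    moreover have "c t\<^sub>1 = x\<^sub>3 - (t\<^sub>3 - t\<^sub>1) *\<^sub>R V" by (simp add: c_def algebra_simps)
    ultimately show ?thesis by simp
  qed
  have axis_close: "dist (t\<^sub>1, x\<^sub>1) (t, c t) < R / 2" if "t\<^sub>1 \<le> t" "t \<le> t\<^sub>3" for t
  proof -
    have "c t = c t\<^sub>1 + (t - t\<^sub>1) *\<^sub>R V" by (simp add: c_def algebra_simps)
    then have ct: "c t = x\<^sub>1 + (t - t\<^sub>1) *\<^sub>R V" by (simp add: c1)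
    have "x\<^sub>3 = x\<^sub>1 + (t\<^sub>3 - t\<^sub>1) *\<^sub>R V" using \<open>t\<^sub>1 < t\<^sub>3\<close> by (simp add: V_def)
    then have "(t\<^sub>3, x\<^sub>3) - (t\<^sub>1, x\<^sub>1) = (t\<^sub>3 - t\<^sub>1) *\<^sub>R (1, V)" by simp
    then have *: "dist (t\<^sub>1, x\<^sub>1) (t\<^sub>3, x\<^sub>3) = (t\<^sub>3 - t\<^sub>1) * norm (1::real, V)"
      using \<open>t\<^sub>1 < t\<^sub>3\<close> by (metis abs_of_pos diff_gt_0_iff_gt dist_commute dist_norm norm_scaleR)
    have "(t, c t) - (t\<^sub>1, x\<^sub>1) = (t - t\<^sub>1) *\<^sub>R (1, V)" by (simp add: ct)
    then have "dist (t\<^sub>1, x\<^sub>1) (t, c t) = (t - t\<^sub>1) * norm (1::real, V)"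
      using that by (metis abs_of_nonneg diff_ge_0_iff_ge dist_commute dist_norm norm_scaleR)
    also have "\<dots> \<le> dist (t\<^sub>1, x\<^sub>1) (t\<^sub>3, x\<^sub>3)" unfolding * using that by (intro mult_right_mono) auto
    finally show ?thesis using P3 by simp
  qed
  define K where "K = {P. t\<^sub>1 \<le> fst P \<and> fst P \<le> t\<^sub>3 \<and> dist (snd P) (c (fst P)) \<le> \<delta>}"
  have K_ball: "K \<subseteq> ball (t\<^sub>1, x\<^sub>1) R"
  proof
    fix P assume "P \<in> K"
    then have "dist (t\<^sub>1, x\<^sub>1) (fst P, c (fst P)) < R / 2" "dist (fst P, c (fst P)) P \<le> \<delta>"
      using axis_close[of "fst P"] by (cases P; auto simp: K_def dist_Pair_Pair dist_commute)+
    then show "P \<in> ball (t\<^sub>1, x\<^sub>1) R"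
      using \<delta>(3) dist_triangle[of "(t\<^sub>1, x\<^sub>1)" P "(fst P, c (fst P))"] by simp
  qed
  have "closed K"
    unfolding K_def c_def by (intro closed_Collect_conj closed_Collect_le continuous_intros)
  moreover have "bounded K" using K_ball bounded_ball bounded_subset by blast
  ultimately have "compact K" by (simp add: compact_eq_bounded_closed)
  define L where "L = 8 * \<theta> + 4 * (\<delta> * norm V + \<bar>\<Lambda>\<bar> + \<bar>B\<bar> * \<delta>)"
  have "L > 0" using \<open>\<theta> > 0\<close> \<delta>(1) by (auto simp: L_def intro!: add_pos_nonneg)
  \<comment> \<open>large enough for \<open>\<kappa> \<sigma>\<^sup>2 - L \<sigma> + 8 \<theta> \<delta>\<^sup>2\<close> to be positive for every \<open>\<sigma>\<close>\<close>
  define \<kappa> where "\<kappa> = L\<^sup>2 / (2 * (8 * \<theta> * \<delta>\<^sup>2))"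
  define E where "E t = exp (\<kappa> * (t - t\<^sub>3))" for t
  define s where "s P = \<delta>\<^sup>2 - (snd P - c (fst P)) \<bullet> (snd P - c (fst P))" for P
  define w where "w P = E (fst P) * (s P)\<^sup>2" for P
  \<comment> \<open>at time \<open>t\<^sub>3\<close> the barrier is at most \<open>\<delta> ^ 4\<close>, and \<open>u \<le> M - m\<close> there\<close>
  define \<epsilon> where "\<epsilon> = m / \<delta> ^ 4"
  have "\<epsilon> > 0" using \<open>m > 0\<close> \<delta>(1) by (simp add: \<epsilon>_def)
  have s_bounds: "0 \<le> s P" "s P \<le> \<delta>\<^sup>2" if "P \<in> K" for P
    using that \<delta>(1) by (auto simp: K_def s_def dist_norm simp flip: power2_norm_eq_inner)
  have "continuous_on K u" using u_cont K_ball ball continuous_on_subset by blast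
  moreover have "continuous_on K w"
    unfolding w_def s_def E_def c_def by (intro continuous_intros)
  ultimately have "continuous_on K (\<lambda>P. u P + \<epsilon> * w P)" by (intro continuous_intros)
  moreover have "(t\<^sub>1, x\<^sub>1) \<in> K" using \<open>t\<^sub>1 < t\<^sub>3\<close> \<delta>(1) by (simp add: K_def c1)
  ultimately obtain P where P: "P \<in> K" "\<And>P'. P' \<in> K \<Longrightarrow> u P' + \<epsilon> * w P' \<le> u P + \<epsilon> * w P"
    using continuous_attains_sup[OF \<open>compact K\<close>, of "\<lambda>P. u P + \<epsilon> * w P"] by blast
  obtain t x where tx: "P = (t, x)" by (cases P)
  have "w (t\<^sub>1, x\<^sub>1) > 0" using \<delta>(1) by (simp add: w_def s_def c1 E_def)
  then have big: "M < u P + \<epsilon> * w P"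
    using P(2)[OF \<open>(t\<^sub>1, x\<^sub>1) \<in> K\<close>] P1 \<open>\<epsilon> > 0\<close> by (smt (verit) mult_pos_pos)
  have PQ: "P \<in> Q" using P(1) K_ball ball by blast
  have "t < t\<^sub>3"
  proof (rule ccontr)
    assume "\<not> t < t\<^sub>3"
    then have t: "t = t\<^sub>3" using P(1) by (simp add: K_def tx)
    have "(s P)\<^sup>2 \<le> (\<delta>\<^sup>2)\<^sup>2" using s_bounds[OF P(1)] by (intro power_mono) auto
    then have "w P \<le> \<delta> ^ 4" by (simp add: w_def E_def tx t flip: power_mult)
    then have "\<epsilon> * w P \<le> \<epsilon> * \<delta> ^ 4" using \<open>\<epsilon> > 0\<close> by (intro mult_left_mono) auto
    also have "\<epsilon> * \<delta> ^ 4 = m" using \<delta>(1) by (simp add: \<epsilon>_def)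
    finally show False using big top[of x] P(1) by (simp add: K_def tx t c3)
  qed
  have "dist x (c t) < \<delta>"
  proof (rule ccontr)
    assume "\<not> dist x (c t) < \<delta>"
    then have "dist x (c t) = \<delta>" using P(1) by (simp add: K_def tx)
    then have "w P = 0" by (simp add: w_def s_def tx dist_norm flip: power2_norm_eq_inner)
    then show False using big u_le[OF PQ] by simp
  qed
  have "open {P. fst P < t\<^sub>3 \<and> dist (snd P) (c (fst P)) < \<delta>}"
    unfolding c_def by (intro open_Collect_conj open_Collect_less continuous_intros)
  then obtain d where d: "d > 0" "ball (t, x) d \<subseteq> {P. fst P < t\<^sub>3 \<and> dist (snd P) (c (fst P)) < \<delta>}"
    using \<open>t < t\<^sub>3\<close> \<open>dist x (c t) < \<delta>\<close> open_contains_ball by (smt (verit) fst_conv mem_Collect_eq snd_conv)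
  define y where "y = x - c t"
  define \<sigma> where "\<sigma> = s P"
  have \<sigma>: "\<sigma> = \<delta>\<^sup>2 - y \<bullet> y" "0 \<le> \<sigma>" using s_bounds[OF P(1)] by (auto simp: \<sigma>_def s_def tx y_def)
  have norm_y: "norm y \<le> \<delta>" using P(1) by (simp add: K_def tx y_def dist_norm)
  have Pball: "P \<in> ball (t\<^sub>1, x\<^sub>1) R" using P(1) K_ball by blast
  show False
  proof (rule no_interior_max[where w = w and \<epsilon> = \<epsilon> and \<delta> = d and t\<^sub>0 = t and x\<^sub>0 = x])
    show "(t, x) \<in> Q" using PQ tx by simp
    show "0 \<le> u (t, x)" using u_nonneg[OF Pball] tx by simp
    show "((\<lambda>t. w (t, x)) has_real_derivative E t * (\<kappa> * \<sigma>\<^sup>2 + 4 * \<sigma> * (y \<bullet> V))) (at t)"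
      using bump_time_deriv[of \<kappa> t\<^sub>3 "\<delta>\<^sup>2" x x\<^sub>3 V t]
      by (simp add: w_def E_def s_def c_def y_def \<sigma>_def tx)
    show "GDERIV (\<lambda>x. w (t, x)) x' :> (- 4 * E t * (\<delta>\<^sup>2 - (x' - c t) \<bullet> (x' - c t))) *\<^sub>R (x' - c t)" for x'
      using gderiv_bump[of "E t" "\<delta>\<^sup>2" "c t" x'] by (simp add: w_def s_def)
    show "((\<lambda>x'. (- 4 * E t * (\<delta>\<^sup>2 - (x' - c t) \<bullet> (x' - c t))) *\<^sub>R (x' - c t)) has_derivative
       (\<lambda>h. (E t *\<^sub>R (8 *\<^sub>R outer y y - (4 * \<sigma>) *\<^sub>R mat 1)) *v h)) (at x)"
      using bump_hessian[of "E t" "\<delta>\<^sup>2" "c t" x] by (simp add: \<sigma>(1) y_def)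
    have tr: "trace (a P ** (8 *\<^sub>R outer y y - (4 * \<sigma>) *\<^sub>R mat 1)) = 8 * (y \<bullet> (a P *v y)) - 4 * \<sigma> * trace (a P)"
      by (simp add: trace_mult_diff matrix_mult_scaleR_right trace_scaleR trace_mult_outer)
    have expr: "E t * (\<kappa> * \<sigma>\<^sup>2 + 4 * \<sigma> * (y \<bullet> V)) + trace (a P ** (E t *\<^sub>R (8 *\<^sub>R outer y y - (4 * \<sigma>) *\<^sub>R mat 1)))
        + b P \<bullet> ((- 4 * E t * \<sigma>) *\<^sub>R y)
      = E t * (\<kappa> * \<sigma>\<^sup>2 + 8 * (y \<bullet> (a P *v y)) - 4 * \<sigma> * (trace (a P) + b P \<bullet> y - y \<bullet> V))"
      unfolding matrix_mult_scaleR_right trace_scaleR tr by (simp add: algebra_simps)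
    have "8 * (y \<bullet> (a P *v y)) \<ge> 8 * \<theta> * (\<delta>\<^sup>2 - \<sigma>)"
      using ellip[OF Pball, of y] by (simp add: \<sigma>(1))
    moreover have "4 * \<sigma> * (trace (a P) + b P \<bullet> y - y \<bullet> V) \<le> 4 * \<sigma> * (\<delta> * norm V + \<bar>\<Lambda>\<bar> + \<bar>B\<bar> * \<delta>)"
    proof (rule mult_left_mono)
      have "b P \<bullet> y \<le> norm (b P) * norm y" by (rule norm_cauchy_schwarz)
      also have "\<dots> \<le> \<bar>B\<bar> * \<delta>" using b_bd[OF Pball] norm_y by (intro mult_mono) auto
      finally have "b P \<bullet> y \<le> \<bar>B\<bar> * \<delta>" .
      moreover have "- (y \<bullet> V) \<le> norm y * norm V" using norm_cauchy_schwarz[of "- y" V] by simp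
      then have "- (y \<bullet> V) \<le> \<delta> * norm V" using norm_y by (smt (verit) mult_right_mono norm_ge_zero)
      ultimately show "trace (a P) + b P \<bullet> y - y \<bullet> V \<le> \<delta> * norm V + \<bar>\<Lambda>\<bar> + \<bar>B\<bar> * \<delta>"
        using a_bd[OF Pball] by linarith
    qed (use \<sigma> in auto)
    moreover have "0 < \<kappa> * \<sigma>\<^sup>2 - L * \<sigma> + 8 * \<theta> * \<delta>\<^sup>2"
      unfolding \<kappa>_def using \<open>L > 0\<close> \<open>\<theta> > 0\<close> \<delta>(1) by (intro quadratic_pos_of_large_leading_coeff) auto
    ultimately have "0 < \<kappa> * \<sigma>\<^sup>2 + 8 * (y \<bullet> (a P *v y)) - 4 * \<sigma> * (trace (a P) + b P \<bullet> y - y \<bullet> V)"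
      by (simp add: L_def algebra_simps)
    then show "0 < E t * (\<kappa> * \<sigma>\<^sup>2 + 4 * \<sigma> * (y \<bullet> V)) +
        trace (a (t, x) ** (E t *\<^sub>R (8 *\<^sub>R outer y y - (4 * \<sigma>) *\<^sub>R mat 1)))
        + b (t, x) \<bullet> ((- 4 * E t * (\<delta>\<^sup>2 - (x - c t) \<bullet> (x - c t))) *\<^sub>R (x - c t))"
      using expr by (simp add: E_def tx \<sigma>(1) y_def)
    show "u (t', x') + \<epsilon> * w (t', x') \<le> u (t, x) + \<epsilon> * w (t, x)"
      if "(t', x') \<in> ball (t, x) d" "t \<le> t'" for t' x'
    proof -
      have "(t', x') \<in> K" using that d(2) P(1) by (force simp: K_def tx)
      then show ?thesis using P(2) tx by simp
    qed
  qed (use \<open>\<epsilon> > 0\<close> d in auto)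
qed

end

section \<open>Propagation along paths\<close>

text \<open>The parameters at which \<open>u = M\<close> form a closed set, whose largest element can be increased unless
  it is 1.\<close>
lemma max_propagates_along_path:
  fixes u :: "real \<times> 'a::real_normed_vector \<Rightarrow> real"
  assumes u_cont: "continuous_on X u"
    and local: "\<And>P. P \<in> X \<Longrightarrow> u P = M \<Longrightarrow>
      \<exists>r>0. \<forall>P'\<in>X \<inter> ball P r. fst P \<le> fst P' \<longrightarrow> u P' = M"
    and \<gamma>: "path \<gamma>" "path_image \<gamma> \<subseteq> X" "mono_on {0..1} (fst \<circ> \<gamma>)"
    and start: "u (pathstart \<gamma>) = M"
  shows "u (pathfinish \<gamma>) = M"
proof -
  have \<gamma>_cont: "continuous_on {0..1} \<gamma>" and \<gamma>_X: "\<And>s. s \<in> {0..1} \<Longrightarrow> \<gamma> s \<in> X"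
    using \<gamma> by (auto simp: path_def path_image_def)
  define S where "S = {s \<in> {0..1}. u (\<gamma> s) = M}"
  have "continuous_on {0..1} (\<lambda>s. u (\<gamma> s))"
    using \<gamma>_cont \<gamma>_X by (intro continuous_on_compose2[OF u_cont]) auto
  then have "closed S"
    unfolding S_def using continuous_closed_preimage_constant by (metis closed_atLeastAtMost)
  then have "compact ({0..1} \<inter> S)" by (intro compact_Int_closed compact_Icc)
  moreover have "{0..1} \<inter> S = S" by (auto simp: S_def)
  ultimately have "compact S" by simp
  moreover have "0 \<in> S" using start by (simp add: S_def pathstart_def)
  ultimately obtain s where s: "s \<in> S" "\<And>s'. s' \<in> S \<Longrightarrow> s' \<le> s"
    using compact_attains_sup[of S] by blast
  then have s01: "s \<in> {0..1}" and us: "u (\<gamma> s) = M" by (auto simp: S_def)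
  have "s = 1"
  proof (rule ccontr)
    assume "s \<noteq> 1"
    obtain r where r: "r > 0" "\<And>P'. P' \<in> X \<Longrightarrow> P' \<in> ball (\<gamma> s) r \<Longrightarrow> fst (\<gamma> s) \<le> fst P' \<Longrightarrow> u P' = M"
      using local[OF \<gamma>_X[OF s01] us] by auto
    obtain d where d: "d > 0" "\<And>s'. s' \<in> {0..1} \<Longrightarrow> dist s' s < d \<Longrightarrow> dist (\<gamma> s') (\<gamma> s) < r"
      using \<gamma>_cont s01 r(1) unfolding continuous_on_iff by meson
    define s' where "s' = min 1 (s + d / 2)"
    have s': "s < s'" "s' \<in> {0..1}" "dist s' s < d"
      using s01 \<open>s \<noteq> 1\<close> d(1) by (auto simp: s'_def dist_real_def min_def)
    have "fst (\<gamma> s) \<le> fst (\<gamma> s')"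
      using mono_onD[OF \<gamma>(3) s01 s'(2)] s'(1) by simp
    then have "u (\<gamma> s') = M"
      using s' d(2) by (intro r(2) \<gamma>_X) (auto simp: dist_commute)
    then have "s' \<in> S" using s'(2) by (simp add: S_def)
    with s(2) s'(1) show False by force
  qed
  with us show ?thesis by (simp add: pathfinish_def)
qed

lemma max_propagates_along_segment:
  fixes u :: "real \<times> 'a::real_normed_vector \<Rightarrow> real"
  assumes "continuous_on X u"
    and "\<And>P. P \<in> X \<Longrightarrow> u P = M \<Longrightarrow>
      \<exists>r>0. \<forall>P'\<in>X \<inter> ball P r. fst P \<le> fst P' \<longrightarrow> u P' = M"
    and seg: "\<And>\<theta>. 0 \<le> \<theta> \<Longrightarrow> \<theta> \<le> 1 \<Longrightarrow> P + \<theta> *\<^sub>R (P' - P) \<in> X" and "fst P \<le> fst P'" and "u P = M"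
  shows "u P' = M"
proof -
  have line: "linepath P P' \<theta> = P + \<theta> *\<^sub>R (P' - P)" for \<theta> by (simp add: linepath_def algebra_simps)
  have "mono_on {0..1} (fst \<circ> linepath P P')"
  proof (rule mono_onI)
    fix r s :: real assume "r \<le> s"
    then have "r * (fst P' - fst P) \<le> s * (fst P' - fst P)"
      using assms(4) by (intro mult_right_mono) auto
    then show "(fst \<circ> linepath P P') r \<le> (fst \<circ> linepath P P') s" by (simp add: line)
  qed
  moreover have "path_image (linepath P P') \<subseteq> X" using seg by (auto simp: path_image_def line)
  ultimately show ?thesis
    using max_propagates_along_path[OF assms(1,2), of "linepath P P'"] assms(5) by simp
qed

context positive_subsolution
begin

text \<open>For strictly later times this is the barrier argument; points of the same time are limits of later
  ones.\<close>
lemma interior_max_locally_constant: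
  assumes u_cont: "continuous_on Q u" and u_le: "\<And>P. P \<in> Q \<Longrightarrow> u P \<le> M" and "M > 0"
    and ellip: "\<And>P. P \<in> Q \<Longrightarrow> \<exists>r>0. \<exists>\<epsilon>>0. \<forall>P'\<in>ball P r \<inter> Q. \<epsilon> \<le> smallest_eigenvalue (a P')"
    and a_bd: "locally_bounded_on Q a" and b_bd: "locally_bounded_on Q b"
    and P: "P \<in> Q" "u P = M"
  shows "\<exists>r>0. \<forall>P'\<in>Q \<inter> ball P r. fst P \<le> fst P' \<longrightarrow> u P' = M"
proof -
  obtain t\<^sub>1 x\<^sub>1 where tx: "P = (t\<^sub>1, x\<^sub>1)" by (cases P)
  obtain r1 where r1: "r1 > 0" "ball P r1 \<subseteq> Q" using open_Q P(1) open_contains_ball by meson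
  obtain r2 \<theta> where r2: "r2 > 0" "\<theta> > 0" "\<And>P'. P' \<in> ball P r2 \<inter> Q \<Longrightarrow> \<theta> \<le> smallest_eigenvalue (a P')"
    using ellip[OF P(1)] by blast
  obtain r3 where r3: "r3 > 0" "bounded (a ` (ball P r3 \<inter> Q))"
    using a_bd P(1) unfolding locally_bounded_on_def by blast
  obtain A where A: "\<And>P'. P' \<in> ball P r3 \<inter> Q \<Longrightarrow> norm (a P') \<le> A"
    using r3(2) unfolding bounded_iff by blast
  obtain r4 where r4: "r4 > 0" "bounded (b ` (ball P r4 \<inter> Q))"
    using b_bd P(1) unfolding locally_bounded_on_def by blast
  obtain B where B: "\<And>P'. P' \<in> ball P r4 \<inter> Q \<Longrightarrow> norm (b P') \<le> B"
    using r4(2) unfolding bounded_iff by blast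
  obtain r5 where r5: "r5 > 0" "\<And>P'. P' \<in> Q \<Longrightarrow> dist P' P < r5 \<Longrightarrow> dist (u P') (u P) < M"
    using u_cont P(1) \<open>M > 0\<close> unfolding continuous_on_iff by meson
  define R where "R = min r1 (min (min r2 r3) (min r4 r5))"
  have R: "R > 0" "R \<le> r1" "R \<le> r2" "R \<le> r3" "R \<le> r4" "R \<le> r5" 
    using r1(1) r2(1) r3(1) r4(1) r5(1) by (auto simp: R_def)
  have ball: "ball P R \<subseteq> Q" using r1 R by auto
  have later: "u P' = M" if P': "P' \<in> ball P (R / 2)" "t\<^sub>1 < fst P'" for P'
  proof -
    have "u (fst P', snd P') = M"
    proof (rule max_propagates_forward_in_ball[OF u_cont u_le _ r2(2)])
      fix X and v :: "real^'n" assume X: "X \<in> ball (t\<^sub>1, x\<^sub>1) R"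
      then have XQ: "X \<in> Q" using ball tx by blast
      have "\<theta> * (v \<bullet> v) \<le> smallest_eigenvalue (a X) * (v \<bullet> v)"
        using r2(3)[of X] X R XQ tx by (intro mult_right_mono) auto
      also have "\<dots> \<le> v \<bullet> (a X *v v)"
        using a_psd[OF XQ] by (intro smallest_eigenvalue_le_quadratic) (simp add: nonneg_definite_symmetric_def)
      finally show "\<theta> * (v \<bullet> v) \<le> v \<bullet> (a X *v v)" .
    next
      fix X assume X: "X \<in> ball (t\<^sub>1, x\<^sub>1) R"
      then have XQ: "X \<in> Q" using ball tx by blast
      have "\<bar>trace (a X)\<bar> \<le> real CARD('n) * norm (a X)" by (rule abs_trace_le)
      also have "\<dots> \<le> real CARD('n) * A" using A[of X] X R XQ tx by (intro mult_left_mono) auto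
      finally show "trace (a X) \<le> real CARD('n) * A" by simp
      show "norm (b X) \<le> B" using B[of X] X R XQ tx by auto
      show "0 \<le> u X" using r5(2)[OF XQ] X R tx P(2) by (auto simp: dist_real_def dist_commute)
    qed (use ball tx P P' in auto)
    then show ?thesis by simp
  qed
  have "u P' = M" if P': "P' \<in> ball P (R / 2)" "t\<^sub>1 \<le> fst P'" for P'
  proof -
    have P'Q: "P' \<in> Q" using P'(1) R(1) ball by force
    have "((\<lambda>s. P' + s *\<^sub>R (1, 0)) \<longlongrightarrow> P' + 0 *\<^sub>R (1, 0)) (at_right (0::real))"
      by (intro tendsto_intros)
    moreover have "P' + 0 *\<^sub>R (1, 0) = P'" by (cases P') simp
    ultimately have lim: "((\<lambda>s. P' + s *\<^sub>R (1, 0)) \<longlongrightarrow> P') (at_right (0::real))" by argo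
    have "\<forall>\<^sub>F s in at_right 0. P' + s *\<^sub>R (1, 0) \<in> ball P (R / 2)"
      using lim P'(1) by (intro topological_tendstoD) auto
    then have ev: "\<forall>\<^sub>F s in at_right 0. u (P' + s *\<^sub>R (1, 0)) = M"
      using eventually_at_right_less[of 0]
    proof eventually_elim
      case (elim s)
      then show ?case using P'(2) by (intro later) auto
    qed
    have "isCont u P'" using u_cont P'Q open_Q continuous_on_eq_continuous_at by blast
    then have "((\<lambda>s. u (P' + s *\<^sub>R (1, 0))) \<longlongrightarrow> u P') (at_right (0::real))"
      using lim by (rule isCont_tendsto_compose)
    moreover have "((\<lambda>s. u (P' + s *\<^sub>R (1, 0))) \<longlongrightarrow> M) (at_right (0::real))"
      using ev by (rule tendsto_eventually)
    ultimately show ?thesis using tendsto_unique trivial_limit_at_right_real by blast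
  qed
  then show ?thesis using R(1) tx by (intro exI[of _ "R / 2"]) auto
qed

end

section \<open>Maxima on the degenerate boundary\<close>

context positive_subsolution
begin

text \<open>Separate differentiability in \<open>t\<close> and \<open>x\<close> with continuous spatial gradient gives total
  differentiability, which is needed to differentiate \<open>u\<close> along oblique lines.\<close>
lemma u_has_derivative:
  assumes "continuous_on Q Du" "P \<in> Q"
  shows "(u has_derivative (\<lambda>h. ut P * fst h + Du P \<bullet> snd h)) (at P)"
proof -
  obtain t x where P: "P = (t, x)" by (cases P)
  obtain A B where AB: "open A" "open B" "(t, x) \<in> A \<times> B" "A \<times> B \<subseteq> Q"
    using open_prod_elim[OF open_Q, of P] assms(2) P by metis
  obtain d where d: "d > 0" "ball x d \<subseteq> B" using AB(2,3) open_contains_ball by blast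
  have sub: "A \<times> ball x d \<subseteq> Q" using AB(4) d(2) by blast
  have "((\<lambda>(t, x). u (t, x)) has_derivative
      (\<lambda>(ht, hx). ut (t, x) * ht + blinfun_apply (blinfun_inner_left (Du (t, x))) hx)) (at (t, x) within A \<times> ball x d)"
  proof (rule has_derivative_partialsI)
    show "((\<lambda>t. u (t, x)) has_derivative (*) (ut (t, x))) (at t within A)"
      using u_time[of "(t, x)"] assms(2) P has_derivative_at_withinI
      by (auto simp: has_field_derivative_def)
    show "((\<lambda>x. u (t', x)) has_derivative blinfun_apply (blinfun_inner_left (Du (t', x')))) (at x' within ball x d)"
      if "t' \<in> A" "x' \<in> ball x d" for t' x'
    proof -
      have "(t', x') \<in> Q" using that sub by blast
      then have "((\<lambda>x. u (t', x)) has_derivative (\<lambda>h. h \<bullet> Du (t', x'))) (at x')"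
        using u_space by (fastforce simp: gderiv_def)
      moreover have "blinfun_apply (blinfun_inner_left (Du (t', x'))) = (\<lambda>h. h \<bullet> Du (t', x'))"
        by (simp add: fun_eq_iff blinfun_inner_left.rep_eq)
      ultimately show ?thesis by (simp add: has_derivative_at_withinI)
    qed
    have "continuous (at (t, x)) Du"
      using assms open_Q P continuous_on_eq_continuous_at by blast
    then have "continuous (at (t, x) within A \<times> ball x d) Du"
      by (rule continuous_at_imp_continuous_at_within)
    then have "continuous (at (t, x) within A \<times> ball x d) (\<lambda>P. blinfun_inner_left (Du P))"
      by (intro continuous_intros)
    then show "continuous (at (t, x) within A \<times> ball x d) (\<lambda>(t, x). blinfun_inner_left (Du (t, x)))"
      by (simp add: case_prod_unfold)
  qed (use d in auto)
  moreover have "at (t, x) within A \<times> ball x d = at (t, x)"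
    using AB d by (intro at_within_open open_Times) auto
  moreover have "(\<lambda>(ht, hx). ut (t, x) * ht + blinfun_apply (blinfun_inner_left (Du (t, x))) hx)
     = (\<lambda>h. ut P * fst h + Du P \<bullet> snd h)"
    by (simp add: fun_eq_iff blinfun_inner_left.rep_eq P inner_commute)
  ultimately show ?thesis using P by simp
qed

text \<open>On the line \<open>P + s (1, b P)\<close> the derivative of \<open>u\<close> is
  \<open>u\<^sub>t + \<langle>b P, Du\<rangle> \<ge> \<langle>b P - b, Du\<rangle> - tr (a D\<^sup>2u)\<close>, and the right-hand side tends to 0 as \<open>s\<close> tends to 0.
  The derivative of \<open>\<epsilon> w\<close> tends to a positive number. So \<open>u + \<epsilon> w\<close> increases strictly when the line
  enters \<open>Q\<close>. As \<open>u\<^sub>t\<close> need not have a limit at \<open>P\<close>, it is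
  first eliminated by means of the differential inequality.\<close>
lemma no_degenerate_boundary_max:
  fixes w :: "real \<times> (real^'n) \<Rightarrow> real"
  assumes Du_cont: "continuous_on Q Du"
    and inward: "0 < \<delta>" "\<And>s. 0 < s \<Longrightarrow> s < \<delta> \<Longrightarrow> P + s *\<^sub>R (1, b P) \<in> Q"
    and lim_u: "(u \<longlongrightarrow> u P) (at P within Q)" and lim_Du: "(Du \<longlongrightarrow> g) (at P within Q)"
    and lim_trace: "((\<lambda>X. trace (a X ** D2u X)) \<longlongrightarrow> 0) (at P within Q)"
    and lim_b: "(b \<longlongrightarrow> b P) (at P within Q)"
    and "0 < u P" "\<epsilon> > 0"
    and w_deriv: "\<And>X. (w has_derivative (\<lambda>h. wt X * fst h + Dw X \<bullet> snd h)) (at X)"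
    and w_cont: "isCont wt P" "isCont Dw P"
    and w_strict: "0 < wt P + b P \<bullet> Dw P"
    and max: "\<And>s. 0 < s \<Longrightarrow> s < \<delta> \<Longrightarrow>
      u (P + s *\<^sub>R (1, b P)) + \<epsilon> * w (P + s *\<^sub>R (1, b P)) \<le> u P + \<epsilon> * w P"
  shows False
proof -
  define L where "L s = P + s *\<^sub>R (1, b P)" for s :: real
  have L0: "L 0 = P" by (cases P) (simp add: L_def)
  have "(L \<longlongrightarrow> P + 0 *\<^sub>R (1, b P)) (at_right 0)"
    unfolding L_def by (intro tendsto_intros)
  then have L_lim: "(L \<longlongrightarrow> P) (at_right 0)" using L0 by (simp add: L_def)
  have "\<forall>\<^sub>F s in at_right 0. s \<in> {0<..<\<delta>}"
    using inward(1) by (rule eventually_at_right_real)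
  then have "\<forall>\<^sub>F s in at_right 0. L s \<in> Q \<and> L s \<noteq> P"
  proof eventually_elim
    case (elim s)
    then show ?case using inward(2)[of s] by (cases P) (auto simp: L_def)
  qed
  then have along: "filterlim L (at P within Q) (at_right 0)"
    using L_lim by (simp add: filterlim_at eventually_conj_iff)
  define y where "y s = u (L s) + \<epsilon> * w (L s)" for s
  define D where "D s = (ut (L s) + Du (L s) \<bullet> b P) + \<epsilon> * (wt (L s) + Dw (L s) \<bullet> b P)" for s
  have y_deriv: "(y has_real_derivative D s) (at s)" if "0 < s" "s < \<delta>" for s
  proof -
    have L_deriv: "(L has_derivative (\<lambda>h. h *\<^sub>R (1, b P))) (at s)"
      unfolding L_def by (auto intro!: derivative_eq_intros)
    have "L s \<in> Q" using inward(2)[OF that] by (simp add: L_def)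
    note has_derivative_compose[OF L_deriv u_has_derivative[OF Du_cont this]]
      has_derivative_compose[OF L_deriv w_deriv]
    then show ?thesis
      unfolding y_def has_field_derivative_def
      by (auto intro!: derivative_eq_intros simp: D_def fun_eq_iff algebra_simps)
  qed
  have "\<forall>\<^sub>F s in at_right 0. 0 < (b P - b (L s)) \<bullet> Du (L s) - trace (a (L s) ** D2u (L s))
      + \<epsilon> * (wt (L s) + Dw (L s) \<bullet> b P)"
  proof (rule order_tendstoD)
    show "((\<lambda>s. (b P - b (L s)) \<bullet> Du (L s) - trace (a (L s) ** D2u (L s))
        + \<epsilon> * (wt (L s) + Dw (L s) \<bullet> b P)) \<longlongrightarrow>
        (b P - b P) \<bullet> g - 0 + \<epsilon> * (wt P + Dw P \<bullet> b P)) (at_right 0)"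
      by (intro tendsto_intros filterlim_compose[OF lim_b along] filterlim_compose[OF lim_Du along]
          filterlim_compose[OF lim_trace along] isCont_tendsto_compose[OF w_cont(1) L_lim]
          isCont_tendsto_compose[OF w_cont(2) L_lim])
    show "0 < (b P - b P) \<bullet> g - 0 + \<epsilon> * (wt P + Dw P \<bullet> b P)"
      using w_strict \<open>\<epsilon> > 0\<close> by (simp add: inner_commute)
  qed
  moreover have "\<forall>\<^sub>F s in at_right 0. 0 < u (L s)"
    using filterlim_compose[OF lim_u along] \<open>0 < u P\<close> by (rule order_tendstoD)
  ultimately have "\<forall>\<^sub>F s in at_right 0. 0 < u (L s) \<and>
      0 < (b P - b (L s)) \<bullet> Du (L s) - trace (a (L s) ** D2u (L s)) + \<epsilon> * (wt (L s) + Dw (L s) \<bullet> b P)"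
    by eventually_elim simp
  then obtain d where d: "d > 0" "\<And>s. 0 < s \<Longrightarrow> s < d \<Longrightarrow> 0 < u (L s)"
      "\<And>s. 0 < s \<Longrightarrow> s < d \<Longrightarrow>
      0 < (b P - b (L s)) \<bullet> Du (L s) - trace (a (L s) ** D2u (L s)) + \<epsilon> * (wt (L s) + Dw (L s) \<bullet> b P)"
    unfolding eventually_at_right_field by auto
  define s\<^sub>1 where "s\<^sub>1 = min d \<delta> / 2"
  have s1: "0 < s\<^sub>1" "s\<^sub>1 < d" "s\<^sub>1 < \<delta>" using d(1) inward(1) by (auto simp: s\<^sub>1_def)
  have "y 0 < y s\<^sub>1"
  proof (rule DERIV_pos_imp_increasing_open[OF s1(1)])
    fix s assume s: "0 < s" "s < s\<^sub>1"
    have LsQ: "L s \<in> Q" using inward(2)[of s] s s1 by (simp add: L_def)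
    have "0 \<le> ut (L s) + trace (a (L s) ** D2u (L s)) + b (L s) \<bullet> Du (L s)"
      using subsol[OF LsQ] d(2)[of s] s s1 by simp
    then have "0 < D s"
      using d(3)[of s] s s1 by (simp add: D_def inner_diff_left inner_diff_right inner_commute)
    then show "\<exists>z. (y has_real_derivative z) (at s) \<and> 0 < z"
      using y_deriv[of s] s s1 by auto
  next
    have "(y \<longlongrightarrow> y 0) (at_right 0)"
      unfolding y_def L0
      using w_deriv[of P]
      by (intro tendsto_intros filterlim_compose[OF lim_u along] isCont_tendsto_compose[OF _ L_lim])
        (rule has_derivative_continuous)
    moreover have "isCont y s" if "0 < s" "s \<le> s\<^sub>1" for s
      using y_deriv[of s] that s1 by (intro DERIV_isCont) auto
    ultimately show "continuous_on {0..s\<^sub>1} y"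
      unfolding continuous_on_eq_continuous_within
      by (metis (no_types, lifting) antisym_conv1 at_within_Icc_at_right atLeastAtMost_iff 
          continuous_at_imp_continuous_at_within continuous_within s1(1) order.order_iff_strict)
  qed
  moreover have "y s\<^sub>1 \<le> y 0" using max[OF s1(1,3)] by (simp add: y_def L0) (simp add: L_def)
  ultimately show False by simp
qed

end

text \<open>The barrier at a boundary point: the linear part provides a positive derivative along \<open>b\<close>, and the
  quadratic part makes it negative on the rim of a cap around \<open>P\<^sub>1\<close>.\<close>
definition tilted_paraboloid :: "real^'n \<Rightarrow> real \<Rightarrow> real \<times> (real^'n) \<Rightarrow> real \<times> (real^'n) \<Rightarrow> real" where
  "tilted_paraboloid m K P\<^sub>1 P = m \<bullet> (snd P - snd P\<^sub>1) -
     K * ((snd P - snd P\<^sub>1) \<bullet> (snd P - snd P\<^sub>1) + (fst P - fst P\<^sub>1)\<^sup>2)"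

lemma tilted_paraboloid_derivatives:
  fixes m x\<^sub>1 :: "real^'n" and t\<^sub>1 K :: real
  defines "w \<equiv> tilted_paraboloid m K (t\<^sub>1, x\<^sub>1)"
  shows "(w has_derivative
      (\<lambda>h. (- 2 * K * (fst P - t\<^sub>1)) * fst h + (m - (2 * K) *\<^sub>R (snd P - x\<^sub>1)) \<bullet> snd h)) (at P)"
    and "((\<lambda>t. w (t, x)) has_real_derivative - 2 * K * (t - t\<^sub>1)) (at t)"
    and "GDERIV (\<lambda>x. w (t, x)) x :> m - (2 * K) *\<^sub>R (x - x\<^sub>1)"
    and "((\<lambda>x. m - (2 * K) *\<^sub>R (x - x\<^sub>1)) has_derivative (\<lambda>h. (- (2 * K)) *\<^sub>R mat 1 *v h)) (at x)"
proof -
  show "(w has_derivative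
      (\<lambda>h. (- 2 * K * (fst P - t\<^sub>1)) * fst h + (m - (2 * K) *\<^sub>R (snd P - x\<^sub>1)) \<bullet> snd h)) (at P)"
    unfolding w_def tilted_paraboloid_def fst_conv snd_conv
    by (auto intro!: derivative_eq_intros simp: fun_eq_iff inner_commute inner_diff_left algebra_simps)
  show "((\<lambda>t. w (t, x)) has_real_derivative - 2 * K * (t - t\<^sub>1)) (at t)"
    unfolding w_def tilted_paraboloid_def fst_conv snd_conv
    by (auto intro!: derivative_eq_intros)
  show "GDERIV (\<lambda>x. w (t, x)) x :> m - (2 * K) *\<^sub>R (x - x\<^sub>1)"
    unfolding w_def tilted_paraboloid_def fst_conv snd_conv gderiv_def
    by (auto intro!: derivative_eq_intros simp: fun_eq_iff inner_commute inner_diff_left inner_diff_right algebra_simps)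
  show "((\<lambda>x. m - (2 * K) *\<^sub>R (x - x\<^sub>1)) has_derivative (\<lambda>h. (- (2 * K)) *\<^sub>R mat 1 *v h)) (at x)"
    unfolding scaleR_matrix_vector_assoc[symmetric] matrix_vector_mul_lid
    by (auto intro!: derivative_eq_intros)
qed

text \<open>\<open>T\<close> stands for the degenerate boundary. Its geometry enters only through local defining functions
  whose gradient \<open>(0, m)\<close> is spatial and satisfies \<open>\<langle>b, m\<rangle> > 0\<close>. The functions \<open>G\<close> and \<open>h\<close> are the
  continuous extensions of \<open>Du\<close> and \<open>tr (a D\<^sup>2u)\<close>.\<close>
locale degenerate_subsolution = positive_subsolution Q a b u ut Du D2u
  for Q :: "(real \<times> (real^'n)) set" and a b u ut Du D2u +
  fixes T :: "(real \<times> (real^'n)) set" and G :: "real \<times> (real^'n) \<Rightarrow> real^'n"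
    and h :: "real \<times> (real^'n) \<Rightarrow> real" and M :: real
  assumes level_set: "P \<in> T \<Longrightarrow> \<exists>F m R. 0 < R \<and> 0 < b P \<bullet> m \<and> F P = 0 \<and>
      continuous_on (ball P R) F \<and> strict_gradient F P (0, m) \<and>
      (\<forall>X\<in>ball P R. (X \<in> Q \<longleftrightarrow> 0 < F X) \<and> (X \<in> T \<longleftrightarrow> F X = 0))"
    and u_cont: "continuous_on (Q \<union> T) u"
    and Du_ext: "continuous_on (Q \<union> T) G" "\<And>P. P \<in> Q \<Longrightarrow> G P = Du P"
    and trace_ext: "continuous_on (Q \<union> T) h" "\<And>P. P \<in> Q \<Longrightarrow> h P = trace (a P ** D2u P)"
      "\<And>P. P \<in> T \<Longrightarrow> h P = 0"
    and a_cont: "P \<in> T \<Longrightarrow> continuous (at P within Q \<union> T) a"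
    and a_zero: "P \<in> T \<Longrightarrow> a P = 0"
    and b_cont: "P \<in> T \<Longrightarrow> continuous (at P within Q \<union> T) b"
    and u_le: "P \<in> Q \<union> T \<Longrightarrow> u P \<le> M"
    and M_pos: "0 < M"
begin

lemma inward_direction:
  assumes "P \<in> T" "strict_gradient F P (0, m)" "0 < R" "F P = 0"
    and Q_iff: "\<And>X. X \<in> ball P R \<Longrightarrow> X \<in> Q \<longleftrightarrow> 0 < F X"
    and "0 < m \<bullet> v"
  shows "\<exists>\<delta>>0. \<forall>s. 0 < s \<and> s < \<delta> \<longrightarrow> P + s *\<^sub>R (1, v) \<in> Q"
proof -
  define N where "N = norm (1::real, v)"
  have "N > 0" by (simp add: N_def norm_Pair add_pos_nonneg)
  obtain \<rho> where \<rho>: "\<rho> > 0" "\<And>x y. x \<in> ball P \<rho> \<Longrightarrow> y \<in> ball P \<rho> \<Longrightarrow>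
      \<bar>F x - F y - (0, m) \<bullet> (x - y)\<bar> \<le> (m \<bullet> v / (2 * N)) * norm (x - y)"
    using strict_gradient_obtains[OF assms(2), of "m \<bullet> v / (2 * N)"] \<open>0 < m \<bullet> v\<close> \<open>N > 0\<close>
    by (metis divide_pos_pos mult_pos_pos zero_less_numeral)
  have "P + s *\<^sub>R (1, v) \<in> Q" if s: "0 < s" "s < min R \<rho> / N" for s
  proof -
    have nrm: "norm (s *\<^sub>R (1::real, v)) = s * N" unfolding norm_scaleR N_def using s(1) by simp
    have d: "dist P (P + s *\<^sub>R (1, v)) = s * N" "norm (P + s *\<^sub>R (1, v) - P) = s * N"
      unfolding dist_add_self add_diff_cancel_left' by (rule nrm)+
    have "s * N < min R \<rho>" using s(2) \<open>N > 0\<close> by (simp add: pos_less_divide_eq)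
    then have inball: "P + s *\<^sub>R (1, v) \<in> ball P R" "P + s *\<^sub>R (1, v) \<in> ball P \<rho>"
      unfolding mem_ball d(1) by auto
    have "\<bar>F (P + s *\<^sub>R (1, v)) - F P - (0, m) \<bullet> (P + s *\<^sub>R (1, v) - P)\<bar> \<le> (m \<bullet> v / (2 * N)) * (s * N)"
      using \<rho>(2)[OF inball(2), of P] \<rho>(1) unfolding d(2) by simp
    moreover have "(m \<bullet> v / (2 * N)) * (s * N) = s * (m \<bullet> v) / 2" using \<open>N > 0\<close> by simp
    moreover have "(0, m) \<bullet> (P + s *\<^sub>R (1, v) - P) = s * (m \<bullet> v)" by simp
    ultimately have "F (P + s *\<^sub>R (1, v)) \<ge> s * (m \<bullet> v) / 2"
      using \<open>F P = 0\<close> by linarith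
    moreover have "s * (m \<bullet> v) / 2 > 0" using s(1) \<open>0 < m \<bullet> v\<close> by simp
    ultimately show ?thesis using Q_iff[OF inball(1)] by linarith
  qed
  moreover have "min R \<rho> / N > 0" using \<open>0 < R\<close> \<rho>(1) \<open>N > 0\<close> by simp
  ultimately show ?thesis by blast
qed

lemma Du_cont: "continuous_on Q Du"
  using continuous_on_subset[OF Du_ext(1), of Q] Du_ext(2) by (auto cong: continuous_on_cong)

lemma no_boundary_max:
  fixes w :: "real \<times> (real^'n) \<Rightarrow> real"
  assumes P: "P \<in> T" and "0 < u P" "\<epsilon> > 0"
    and w: "\<And>X. (w has_derivative (\<lambda>h. wt X * fst h + Dw X \<bullet> snd h)) (at X)"
      "isCont wt P" "isCont Dw P" "0 < wt P + b P \<bullet> Dw P"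
    and "d > 0" and max: "\<And>X. X \<in> Q \<inter> ball P d \<Longrightarrow> u X + \<epsilon> * w X \<le> u P + \<epsilon> * w P"
  shows False
proof -
  from level_set[OF P] obtain F m R where F: "0 < R" "0 < b P \<bullet> m" "F P = 0" "strict_gradient F P (0, m)"
    and Q_iff: "\<And>X. X \<in> ball P R \<Longrightarrow> X \<in> Q \<longleftrightarrow> 0 < F X" by blast
  obtain \<delta> where \<delta>: "\<delta> > 0" "\<And>s. 0 < s \<Longrightarrow> s < \<delta> \<Longrightarrow> P + s *\<^sub>R (1, b P) \<in> Q"
    using inward_direction[OF P F(4,1,3) Q_iff, of "b P"] F(2) by (auto simp: inner_commute)
  define N where "N = norm (1::real, b P)"
  have "N > 0" by (simp add: N_def norm_Pair add_pos_nonneg)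
  define \<delta>' where "\<delta>' = min \<delta> (d / N)"
  have near: "P + s *\<^sub>R (1, b P) \<in> Q \<inter> ball P d" if s: "0 < s" "s < \<delta>'" for s
  proof -
    have "norm (s *\<^sub>R (1::real, b P)) = s * N" unfolding norm_scaleR N_def using s(1) by simp
    then have "dist P (P + s *\<^sub>R (1, b P)) = s * N" unfolding dist_add_self .
    also have "\<dots> < d" using s \<open>N > 0\<close> by (simp add: \<delta>'_def pos_less_divide_eq)
    finally show ?thesis using \<delta>(2)[of s] s by (simp add: \<delta>'_def)
  qed
  have QT: "P \<in> Q \<union> T" using P by simp
  have lim: "(f \<longlongrightarrow> f P) (at P within Q)" if "continuous_on (Q \<union> T) f" for f :: "_ \<Rightarrow> 'b::metric_space"
    using that QT unfolding continuous_on_def by (meson Un_upper1 tendsto_within_subset)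
  show False
  proof (rule no_degenerate_boundary_max[OF Du_cont, where \<delta> = \<delta>' and P = P and g = "G P"])
    show "(u \<longlongrightarrow> u P) (at P within Q)" by (rule lim[OF u_cont])
    have "\<forall>\<^sub>F X in at P within Q. X \<in> Q" by (simp add: eventually_at_filter)
    then have "\<forall>\<^sub>F X in at P within Q. G X = Du X \<and> h X = trace (a X ** D2u X)"
      by eventually_elim (simp add: Du_ext(2) trace_ext(2))
    then have ev: "\<forall>\<^sub>F X in at P within Q. G X = Du X" 
        "\<forall>\<^sub>F X in at P within Q. h X = trace (a X ** D2u X)"
      by (auto simp: eventually_conj_iff)
    show "(Du \<longlongrightarrow> G P) (at P within Q)"
      using lim[OF Du_ext(1)] ev(1) by (rule Lim_transform_eventually)
    show "((\<lambda>X. trace (a X ** D2u X)) \<longlongrightarrow> 0) (at P within Q)"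
      using lim[OF trace_ext(1)] ev(2) unfolding trace_ext(3)[OF P] by (rule Lim_transform_eventually)
    show "(b \<longlongrightarrow> b P) (at P within Q)"
      using b_cont[OF P] unfolding continuous_within by (rule tendsto_within_subset) simp
    show "u (P + s *\<^sub>R (1, b P)) + \<epsilon> * w (P + s *\<^sub>R (1, b P)) \<le> u P + \<epsilon> * w P"
      if "0 < s" "s < \<delta>'" for s using near[OF that] by (rule max)
    show "0 < \<delta>'" using \<delta>(1) \<open>d > 0\<close> \<open>N > 0\<close> by (simp add: \<delta>'_def)
  qed (use near w \<open>0 < u P\<close> \<open>\<epsilon> > 0\<close> in auto)
qed

text \<open>The parameters are chosen in this order. The slope \<open>k\<close> is small compared with \<open>\<langle>b, m\<rangle>\<close>; then the
  radius \<open>\<rho>\<close> is so small that the defining function deviates from its linear part by at most a small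
  multiple of \<open>k \<rho>\<close>; finally the height \<open>h'\<close> of the cap is so small that \<open>tr a\<close> is at most \<open>\<rho>\<close> in it, which
  compensates the large second derivatives, of order \<open>k / \<rho>\<close>, of the barrier.\<close>
lemma degenerate_max_approached_from_interior:
  assumes P1: "P\<^sub>1 \<in> T" "u P\<^sub>1 = M" and "r > 0"
  shows "\<exists>P\<in>Q \<inter> ball P\<^sub>1 r. u P = M"
proof (rule ccontr)
  assume "\<not> ?thesis"
  then have u_less: "u P < M" if "P \<in> Q" "P \<in> ball P\<^sub>1 r" for P
    using that u_le[of P] by force
  obtain t\<^sub>1 x\<^sub>1 where tx: "P\<^sub>1 = (t\<^sub>1, x\<^sub>1)" by (cases P\<^sub>1)
  from level_set[OF P1(1)] obtain F m R where R: "0 < R" and bm: "0 < b P\<^sub>1 \<bullet> m" and F0: "F P\<^sub>1 = 0"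
    and F_cont: "continuous_on (ball P\<^sub>1 R) F" and strict: "strict_gradient F P\<^sub>1 (0, m)"
    and iff: "\<And>X. X \<in> ball P\<^sub>1 R \<Longrightarrow> (X \<in> Q \<longleftrightarrow> 0 < F X)" "\<And>X. X \<in> ball P\<^sub>1 R \<Longrightarrow> (X \<in> T \<longleftrightarrow> F X = 0)" by blast
  define \<beta> where "\<beta> = b P\<^sub>1 \<bullet> m"
  have "\<beta> > 0" using bm by (simp add: \<beta>_def)
  define B where "B = norm (b P\<^sub>1) + 1"
  have "B > 0" by (simp add: B_def add_nonneg_pos)
  \<comment> \<open>the error terms of the barrier are at most \<open>2 k (1 + B)\<close> and \<open>2 k\<close>, together less than \<open>\<beta> / 2\<close>\<close>
  define k where "k = \<beta> / (16 * (1 + B))"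
  have "k > 0" using \<open>\<beta> > 0\<close> \<open>B > 0\<close> by (simp add: k_def)
  have k_eq: "16 * k * (1 + B) = \<beta>" using \<open>B > 0\<close> by (simp add: k_def field_simps)
  \<comment> \<open>a change of \<open>b\<close> by less than \<open>\<eta>\<close> keeps \<open>\<langle>b, m\<rangle> \<ge> \<beta> / 2\<close> and \<open>norm b \<le> B\<close>\<close>
  define \<eta> where "\<eta> = min 1 (\<beta> / (2 * (norm m + 1)))"
  have "norm m + 1 > 0" by (simp add: add_nonneg_pos)
  then have "\<eta> > 0" using \<open>\<beta> > 0\<close> by (simp add: \<eta>_def)
  obtain r\<^sub>0 where r0: "r\<^sub>0 > 0" "\<forall>P\<in>Q \<union> T. dist P P\<^sub>1 < r\<^sub>0 \<longrightarrow> dist (b P) (b P\<^sub>1) < \<eta>"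
    using continuous_within_dist_less[OF b_cont[OF P1(1)] \<open>\<eta> > 0\<close>] by (elim exE conjE)
  obtain r\<^sub>1 where r1: "r\<^sub>1 > 0" "\<And>x y. x \<in> ball P\<^sub>1 r\<^sub>1 \<Longrightarrow> y \<in> ball P\<^sub>1 r\<^sub>1 \<Longrightarrow>
      \<bar>F x - F y - (0, m) \<bullet> (x - y)\<bar> \<le> (k / 4) * norm (x - y)"
    using strict_gradient_obtains[OF strict, of "k / 4"] \<open>k > 0\<close> by auto
  have "continuous (at P\<^sub>1 within Q \<union> T) u"
    using u_cont P1(1) by (simp add: continuous_on_eq_continuous_within)
  then obtain r\<^sub>2 where r2: "r\<^sub>2 > 0" "\<forall>P\<in>Q \<union> T. dist P P\<^sub>1 < r\<^sub>2 \<longrightarrow> dist (u P) (u P\<^sub>1) < M"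
    using continuous_within_dist_less[OF _ M_pos] by blast
  define \<rho> where "\<rho> = min (min r R) (min r\<^sub>0 (min r\<^sub>1 r\<^sub>2)) / 2"
  have \<rho>: "\<rho> > 0" "\<rho> < r" "\<rho> < R" "\<rho> < r\<^sub>0" "\<rho> < r\<^sub>1" "\<rho> < r\<^sub>2"
    using \<open>r > 0\<close> R r0(1) r1(1) r2(1) by (auto simp: \<rho>_def)
  have cball: "cball P\<^sub>1 \<rho> \<subseteq> ball P\<^sub>1 R" using \<rho> by auto
  define C where "C = {P \<in> cball P\<^sub>1 \<rho>. 0 \<le> F P}"
  have F_cont': "continuous_on (cball P\<^sub>1 \<rho>) F" using F_cont cball by (rule continuous_on_subset)
  have closed_level: "closed {P \<in> cball P\<^sub>1 \<rho>. c \<le> F P \<and> F P \<le> c'}" for c c'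
    using continuous_closed_preimage[OF F_cont' closed_cball, of "{c..c'}"]
    by (simp add: vimage_def Int_def conj_commute)
  have "closed C"
    using continuous_closed_preimage[OF F_cont' closed_cball, of "{0..}"]
    by (simp add: C_def vimage_def Int_def conj_commute)
  moreover have "bounded C" using bounded_cball by (rule bounded_subset) (auto simp: C_def)
  ultimately have "compact C" by (simp add: compact_eq_bounded_closed)
  have C_Q: "P \<in> Q \<longleftrightarrow> 0 < F P" and C_T: "P \<in> T \<longleftrightarrow> F P = 0" and C_QT: "P \<in> Q \<union> T" if "P \<in> C" for P
  proof -
    have "P \<in> ball P\<^sub>1 R" "0 \<le> F P" using that cball by (auto simp: C_def)
    then show "P \<in> Q \<longleftrightarrow> 0 < F P" "P \<in> T \<longleftrightarrow> F P = 0" "P \<in> Q \<union> T" using iff[of P] by auto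
  qed
  have C_dist: "dist P P\<^sub>1 \<le> \<rho>" if "P \<in> C" for P using that by (simp add: C_def dist_commute)
  have u_pos: "0 < u P" if "P \<in> C" for P
    using r2(2)[rule_format, OF C_QT[OF that]] C_dist[OF that] \<rho>(6) P1(2) by (auto simp: dist_real_def abs_less_iff)
  have b_near: "dist (b P) (b P\<^sub>1) < \<eta>" if "P \<in> C" for P
    using r0(2)[rule_format, OF C_QT[OF that]] C_dist[OF that] \<rho>(4) by simp
  have b_bd: "norm (b P) \<le> B" if "P \<in> C" for P
    using b_near[OF that] norm_triangle_ineq2[of "b P" "b P\<^sub>1"] by (simp add: dist_norm \<eta>_def B_def)
  have b_m: "b P \<bullet> m \<ge> \<beta> / 2" if "P \<in> C" for P
  proof -
    have "(b P\<^sub>1 - b P) \<bullet> m \<le> norm (b P\<^sub>1 - b P) * norm m" by (rule norm_cauchy_schwarz)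
    also have "\<dots> \<le> \<eta> * (norm m + 1)"
      using b_near[OF that] \<open>\<eta> > 0\<close> by (intro mult_mono) (auto simp: dist_norm norm_minus_commute)
    also have "\<dots> \<le> (\<beta> / (2 * (norm m + 1))) * (norm m + 1)"
      by (intro mult_right_mono) (auto simp: \<eta>_def)
    also have "\<dots> = \<beta> / 2" using \<open>norm m + 1 > 0\<close> by (simp add: field_simps)
    finally show ?thesis by (simp add: inner_diff_left \<beta>_def)
  qed
  \<comment> \<open>the points of the cap with large \<open>tr a\<close> do not accumulate at the boundary, where \<open>a\<close> is continuous and 0\<close>
  obtain h\<^sub>0 where h0: "h\<^sub>0 > 0" "\<And>P. P \<in> C \<Longrightarrow> F P < h\<^sub>0 \<Longrightarrow> \<bar>trace (a P)\<bar> \<le> \<rho>"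
  proof -
    define S where "S = {P \<in> C. \<bar>trace (a P)\<bar> > \<rho>}"
    have "closure S \<subseteq> C" using \<open>closed C\<close> by (intro closure_minimal) (auto simp: S_def)
    then have "compact (closure S)" using \<open>compact C\<close> by (metis closed_closure compact_Int_closed inf.absorb2)
    show thesis
    proof (cases "S = {}")
      case True
      then show ?thesis using that[of 1] by (force simp: S_def)
    next
      case False
      have "continuous_on (closure S) F"
        using \<open>closure S \<subseteq> C\<close> by (intro continuous_on_subset[OF F_cont']) (auto simp: C_def)
      moreover have "closure S \<noteq> {}" using False by simp
      ultimately have "\<exists>P\<in>closure S. \<forall>X\<in>closure S. F P \<le> F X"
        by (intro continuous_attains_inf[OF \<open>compact (closure S)\<close>])
      then obtain P where P: "P \<in> closure S" "\<forall>X\<in>closure S. F P \<le> F X" by (elim bexE)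
      have "P \<in> C" using P(1) \<open>closure S \<subseteq> C\<close> by blast
      have "F P \<noteq> 0"
      proof
        assume "F P = 0"
        then have "P \<in> T" using C_T[OF \<open>P \<in> C\<close>] by simp
        have "\<rho> / real CARD('n) > 0" using \<rho>(1) by simp
        obtain d where d: "d > 0" "\<forall>X\<in>Q \<union> T. dist X P < d \<longrightarrow> dist (a X) (a P) < \<rho> / real CARD('n)"
          using continuous_within_dist_less[OF a_cont[OF \<open>P \<in> T\<close>] \<open>\<rho> / real CARD('n) > 0\<close>]
          by (elim exE conjE)
        obtain X where X: "X \<in> S" "dist X P < d" using P(1) d(1) closure_approachable by blast
        have "\<bar>trace (a X)\<bar> \<le> real CARD('n) * norm (a X)" by (rule abs_trace_le)
        also have "\<dots> \<le> real CARD('n) * (\<rho> / real CARD('n))"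
          using d(2)[rule_format, of X] X C_QT[of X] a_zero[OF \<open>P \<in> T\<close>] by (intro mult_left_mono) (auto simp: S_def)
        also have "\<dots> = \<rho>" by simp
        finally show False using X(1) by (simp add: S_def)
      qed
      then have "F P > 0" using \<open>P \<in> C\<close> by (simp add: C_def)
      then show ?thesis
      proof (rule that)
        fix X assume "X \<in> C" "F X < F P"
        then show "\<bar>trace (a X)\<bar> \<le> \<rho>"
          using P(2)[rule_format, of X] closure_subset[of S] by (force simp: S_def)
      qed
    qed
  qed
  define h' where "h' = min (h\<^sub>0 / 2) (k * \<rho> / 4)"
  have h': "h' > 0" "h' < h\<^sub>0" "h' \<le> k * \<rho> / 4" using h0(1) \<open>k > 0\<close> \<rho>(1) by (auto simp: h'_def)
  define W where "W = {P \<in> C. F P \<le> h'}"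
  have "compact W"
  proof -
    have "W = C \<inter> {P \<in> cball P\<^sub>1 \<rho>. 0 \<le> F P \<and> F P \<le> h'}" by (auto simp: W_def C_def)
    then show ?thesis using compact_Int_closed[OF \<open>compact C\<close> closed_level[of 0 h']] by simp
  qed
  define lid where "lid = {P \<in> C. F P = h'}"
  have "compact lid"
  proof -
    have "lid = C \<inter> {P \<in> cball P\<^sub>1 \<rho>. h' \<le> F P \<and> F P \<le> h'}" by (auto simp: lid_def C_def)
    then show ?thesis using compact_Int_closed[OF \<open>compact C\<close> closed_level[of h' h']] by simp
  qed
  have C_cont: "continuous_on S u" if "S \<subseteq> C" for S
    using u_cont C_QT that by (intro continuous_on_subset[OF u_cont]) blast
  obtain \<mu> where \<mu>: "\<mu> > 0" "\<And>P. P \<in> lid \<Longrightarrow> u P \<le> M - \<mu>"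
  proof (cases "lid = {}")
    case False
    have "continuous_on lid u" by (rule C_cont) (auto simp: lid_def)
    from continuous_attains_sup[OF \<open>compact lid\<close> False this]
    obtain P where P: "P \<in> lid" "\<forall>X\<in>lid. u X \<le> u P" by (elim bexE)
    then have "P \<in> C" "F P > 0" using h'(1) by (auto simp: lid_def)
    then have "u P < M"
      using C_Q C_dist[of P] \<rho>(2) by (intro u_less) (auto simp: dist_commute)
    then show ?thesis using P(2) that[of "M - u P"] by simp
  qed (use that[of 1] in auto)
  define K where "K = k / \<rho>"
  have K\<rho>: "K * \<rho> = k" and "K > 0" using \<rho>(1) \<open>k > 0\<close> by (auto simp: K_def)
  define w where "w = tilted_paraboloid m K P\<^sub>1"
  have w_eq: "w P = m \<bullet> (snd P - x\<^sub>1) - K * ((snd P - x\<^sub>1) \<bullet> (snd P - x\<^sub>1) + (fst P - t\<^sub>1)\<^sup>2)" for P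
    by (simp add: w_def tilted_paraboloid_def tx)
  define wt where "wt P = - 2 * K * (fst P - t\<^sub>1)" for P :: "real \<times> (real^'n)"
  define Dw where "Dw P = m - (2 * K) *\<^sub>R (snd P - x\<^sub>1)" for P :: "real \<times> (real^'n)"
  note w_derivs = tilted_paraboloid_derivatives(1-3)[where m = m and K = K and t\<^sub>1 = t\<^sub>1 and x\<^sub>1 = x\<^sub>1,
      folded tx, folded w_def]
  have dist_sq: "(snd P - x\<^sub>1) \<bullet> (snd P - x\<^sub>1) + (fst P - t\<^sub>1)\<^sup>2 = (dist P P\<^sub>1)\<^sup>2" for P
    unfolding dist_norm power2_norm_eq_inner inner_prod_def
    by (simp add: tx power2_eq_square inner_real_def)
  have w_bound: "w P \<le> norm m * \<rho>" if "P \<in> C" for P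
  proof -
    have "m \<bullet> (snd P - x\<^sub>1) \<le> norm m * norm (snd P - x\<^sub>1)" by (rule norm_cauchy_schwarz)
    also have "\<dots> \<le> norm m * \<rho>"
      using C_dist[OF that] dist_snd_le[of P P\<^sub>1] by (intro mult_left_mono) (auto simp: tx dist_norm)
    finally show ?thesis using \<open>K > 0\<close> unfolding w_eq dist_sq by (smt (verit) mult_nonneg_nonneg zero_le_power2)
  qed
  have strict_first_order: "wt P + b P \<bullet> Dw P \<ge> \<beta> / 2 - 2 * k * (1 + B)" if "P \<in> C" for P
  proof -
    have "\<bar>fst P - t\<^sub>1\<bar> \<le> \<rho>" using C_dist[OF that] dist_fst_le[of P P\<^sub>1] by (simp add: tx dist_real_def)
    then have "K * (fst P - t\<^sub>1) \<le> K * \<rho>" using \<open>K > 0\<close> by (intro mult_left_mono) auto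
    then have "wt P \<ge> - 2 * k" using K\<rho> by (simp add: wt_def)
    moreover have "b P \<bullet> (snd P - x\<^sub>1) \<le> B * \<rho>"
    proof -
      have "b P \<bullet> (snd P - x\<^sub>1) \<le> norm (b P) * norm (snd P - x\<^sub>1)" by (rule norm_cauchy_schwarz)
      also have "\<dots> \<le> B * \<rho>"
        using C_dist[OF that] dist_snd_le[of P P\<^sub>1] b_bd[OF that] \<open>B > 0\<close> by (intro mult_mono) (auto simp: tx dist_norm)
      finally show ?thesis .
    qed
    then have "K * (b P \<bullet> (snd P - x\<^sub>1)) \<le> K * (B * \<rho>)" using \<open>K > 0\<close> by (intro mult_left_mono) auto
    moreover have "K * (B * \<rho>) = k * B" using K\<rho> by (metis mult.assoc mult.commute)
    moreover have "b P \<bullet> Dw P = b P \<bullet> m - 2 * (K * (b P \<bullet> (snd P - x\<^sub>1)))"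
      by (simp add: Dw_def inner_diff_right)
    moreover have "2 * k * (1 + B) = 2 * k + 2 * (k * B)" by (simp add: algebra_simps)
    ultimately show ?thesis using b_m[OF that] by linarith
  qed
  define \<epsilon> where "\<epsilon> = \<mu> / (norm m * \<rho> + 1)"
  have den: "norm m * \<rho> + 1 > 0" using \<rho>(1) by (simp add: add_nonneg_pos)
  have "\<epsilon> > 0" using \<mu>(1) den by (simp add: \<epsilon>_def)
  have P1_W: "P\<^sub>1 \<in> W" using \<rho>(1) F0 h'(1) by (simp add: W_def C_def)
  have "continuous_on W u" by (rule C_cont) (auto simp: W_def)
  moreover have "continuous_on W w" unfolding w_eq by (intro continuous_intros)
  ultimately have "continuous_on W (\<lambda>P. u P + \<epsilon> * w P)" by (intro continuous_intros)
  moreover have "W \<noteq> {}" using P1_W by auto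
  ultimately have "\<exists>P\<in>W. \<forall>X\<in>W. u X + \<epsilon> * w X \<le> u P + \<epsilon> * w P"
    by (intro continuous_attains_sup[OF \<open>compact W\<close>])
  then obtain P where P: "P \<in> W" "\<forall>X\<in>W. u X + \<epsilon> * w X \<le> u P + \<epsilon> * w P" by (elim bexE)
  have PC: "P \<in> C" and FP: "F P \<le> h'" using P(1) by (auto simp: W_def)
  have big: "M \<le> u P + \<epsilon> * w P" using P(2)[rule_format, OF P1_W] P1(2) by (simp add: w_eq tx)
  have "F P \<noteq> h'"
  proof
    assume "F P = h'"
    then have "u P \<le> M - \<mu>" using PC by (intro \<mu>(2)) (simp add: lid_def)
    moreover have "\<epsilon> * w P \<le> \<epsilon> * (norm m * \<rho>)"
      using w_bound[OF PC] \<open>\<epsilon> > 0\<close> by (intro mult_left_mono) auto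
    moreover have "\<epsilon> * (norm m * \<rho>) < \<epsilon> * (norm m * \<rho> + 1)" using \<open>\<epsilon> > 0\<close> by simp
    moreover have "\<epsilon> * (norm m * \<rho> + 1) = \<mu>" using den by (simp add: \<epsilon>_def)
    ultimately show False using big by linarith
  qed
  then have FP': "F P < h'" using FP by simp
  \<comment> \<open>on the rim the quadratic part \<open>- k \<rho>\<close> outweighs the linear part, which is at most \<open>k \<rho> / 2\<close>\<close>
  have "dist P P\<^sub>1 \<noteq> \<rho>"
  proof
    assume d: "dist P P\<^sub>1 = \<rho>"
    have "\<bar>F P - F P\<^sub>1 - (0, m) \<bullet> (P - P\<^sub>1)\<bar> \<le> (k / 4) * norm (P - P\<^sub>1)"
      using d \<rho> by (intro r1(2)) (auto simp: dist_commute)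
    then have "\<bar>F P - m \<bullet> (snd P - x\<^sub>1)\<bar> \<le> (k / 4) * \<rho>"
      using d F0 by (simp add: dist_norm inner_prod_def tx)
    then have "m \<bullet> (snd P - x\<^sub>1) \<le> k * \<rho> / 4 + k * \<rho> / 4" using FP h'(3) by linarith
    moreover have "K * \<rho>\<^sup>2 = k * \<rho>" using K\<rho> by (simp add: power2_eq_square)
    moreover have "k * \<rho> > 0" using \<open>k > 0\<close> \<rho>(1) by simp
    ultimately have "w P < 0" unfolding w_eq dist_sq d by linarith
    then have "\<epsilon> * w P < 0" using \<open>\<epsilon> > 0\<close> by (simp add: mult_pos_neg)
    then show False using big u_le[OF C_QT[OF PC]] by linarith
  qed
  then have dP: "dist P\<^sub>1 P < \<rho>" using C_dist[OF PC] by (simp add: dist_commute)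
  have "open {X \<in> ball P\<^sub>1 \<rho>. F X < h'}"
    using continuous_open_preimage[OF continuous_on_subset[OF F_cont', of "ball P\<^sub>1 \<rho>"] open_ball open_lessThan[of h']]
    by (simp add: vimage_def Int_def conj_commute subset_iff)
  moreover have "P \<in> {X \<in> ball P\<^sub>1 \<rho>. F X < h'}" using dP FP' by simp
  ultimately obtain d where d: "d > 0" "ball P d \<subseteq> {X \<in> ball P\<^sub>1 \<rho>. F X < h'}"
    using open_contains_ball by blast
  have near: "X \<in> W" if X: "X \<in> Q" "X \<in> ball P d" for X
  proof -
    have "X \<in> ball P\<^sub>1 \<rho>" "F X < h'" using X(2) d(2) by auto
    then show ?thesis using iff(1)[of X] X(1) \<rho>(3) by (auto simp: W_def C_def)
  qed
  have kB: "2 * k * (1 + B) = \<beta> / 8" using k_eq by (simp add: algebra_simps)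
  show False
  proof (cases "F P = 0")
    case True
    show False
    proof (rule no_boundary_max[where P = P and w = w and wt = wt and Dw = Dw and \<epsilon> = \<epsilon> and d = d])
      show "P \<in> T" using True C_T[OF PC] by simp
      show "(w has_derivative (\<lambda>h. wt X * fst h + Dw X \<bullet> snd h)) (at X)" for X
        using w_derivs(1)[of X] by (simp only: wt_def Dw_def)
      show "isCont wt P" unfolding wt_def by (intro continuous_intros)
      show "isCont Dw P" unfolding Dw_def by (intro continuous_intros)
      show "0 < wt P + b P \<bullet> Dw P" using strict_first_order[OF PC] kB \<open>\<beta> > 0\<close> by linarith
      show "u X + \<epsilon> * w X \<le> u P + \<epsilon> * w P" if "X \<in> Q \<inter> ball P d" for X
        using that near by (intro P(2)[rule_format]) auto
    qed (use u_pos[OF PC] \<open>\<epsilon> > 0\<close> d(1) in auto)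
  next
    case False
    then have PQ: "P \<in> Q" using PC C_Q by (simp add: C_def)
    obtain t x where Ptx: "P = (t, x)" by (cases P)
    obtain d' where d': "d' > 0" "ball P d' \<subseteq> Q" using open_Q PQ open_contains_ball by blast
    show False
    proof (rule no_interior_max[where t\<^sub>0 = t and x\<^sub>0 = x and w = w and \<epsilon> = \<epsilon> and \<delta> = "min d d'"
          and Dw = "\<lambda>x. m - (2 * K) *\<^sub>R (x - x\<^sub>1)"])
      show "((\<lambda>t. w (t, x)) has_real_derivative - 2 * K * (t - t\<^sub>1)) (at t)" by (rule w_derivs)
      show "GDERIV (\<lambda>x. w (t, x)) x' :> m - (2 * K) *\<^sub>R (x' - x\<^sub>1)" for x' by (rule w_derivs)
      show "((\<lambda>x. m - (2 * K) *\<^sub>R (x - x\<^sub>1)) has_derivative (\<lambda>h. (- (2 * K)) *\<^sub>R mat 1 *v h)) (at x)"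
        by (rule tilted_paraboloid_derivatives(4))
      have "K * trace (a P) \<le> K * \<rho>"
        using h0(2)[OF PC] FP h'(2) \<open>K > 0\<close> by (intro mult_left_mono) auto
      then have "trace (a P ** ((- (2 * K)) *\<^sub>R mat 1)) \<ge> - 2 * k"
        unfolding matrix_mult_scaleR_right trace_scaleR using K\<rho> by simp
      moreover have "2 * k \<le> 2 * k * (1 + B)" using \<open>k > 0\<close> \<open>B > 0\<close> by simp
      ultimately have "0 < wt P + trace (a P ** ((- (2 * K)) *\<^sub>R mat 1)) + b P \<bullet> Dw P"
        using strict_first_order[OF PC] kB \<open>\<beta> > 0\<close> by linarith
      then show "0 < - 2 * K * (t - t\<^sub>1) + trace (a (t, x) ** ((- (2 * K)) *\<^sub>R mat 1)) + b (t, x) \<bullet> (m - (2 * K) *\<^sub>R (x - x\<^sub>1))"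
        by (simp add: wt_def Dw_def Ptx)
      show "u (t', x') + \<epsilon> * w (t', x') \<le> u (t, x) + \<epsilon> * w (t, x)"
        if "(t', x') \<in> ball (t, x) (min d d')" for t' x'
      proof -
        have "(t', x') \<in> W" using that d' Ptx by (intro near) auto
        then show ?thesis using P(2) Ptx by simp
      qed
    qed (use PQ u_pos[OF PC] Ptx \<open>\<epsilon> > 0\<close> d(1) d'(1) in auto)
  qed
qed

end

section \<open>Propagation from the degenerate boundary\<close>

context degenerate_subsolution
begin

text \<open>Moving along \<open>(0, m)\<close> keeps the time fixed and leads away from the boundary; at distance \<open>8 \<rho>\<close> there
  is enough room to move straight between points of the ball of radius \<open>\<rho>\<close>. The three pieces make up a
  polygon in \<open>Q\<close> along which the time is monotone.\<close>
lemma points_connected_near_degenerate_boundary: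
  assumes strict: "strict_gradient F P (0, m)" and "m \<noteq> 0" "0 < R"
    and "\<forall>X\<in>ball P R. X \<in> Q \<longleftrightarrow> 0 < F X"
  shows "\<exists>\<rho>>0. \<exists>\<sigma>>0.
    (\<forall>X\<in>Q \<inter> ball P \<rho>. \<forall>s\<in>{0..\<sigma>}. X + s *\<^sub>R (0, m) \<in> Q) \<and>
    (\<forall>X\<in>Q \<inter> ball P \<rho>. \<forall>Y\<in>Q \<inter> ball P \<rho>. \<forall>\<theta>\<in>{0..1}. X + \<sigma> *\<^sub>R (0, m) + \<theta> *\<^sub>R (Y - X) \<in> Q)"
proof -
  define \<mu> where "\<mu> = norm m"
  have "\<mu> > 0" using \<open>m \<noteq> 0\<close> by (simp add: \<mu>_def)
  obtain r where r: "r > 0" "\<And>x y. x \<in> ball P r \<Longrightarrow> y \<in> ball P r \<Longrightarrow>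
      \<bar>F x - F y - (0, m) \<bullet> (x - y)\<bar> \<le> (\<mu> / 2) * norm (x - y)"
    using strict_gradient_obtains[OF strict, of "\<mu> / 2"] \<open>\<mu> > 0\<close> by auto
  \<comment> \<open>a displacement of length at most \<open>10 \<rho>\<close> from the ball of radius \<open>\<rho>\<close> stays within \<open>11 \<rho>\<close>\<close>
  define \<rho> where "\<rho> = min r R / 11"
  have \<rho>: "\<rho> > 0" "11 * \<rho> \<le> r" "11 * \<rho> \<le> R" using r(1) \<open>0 < R\<close> by (auto simp: \<rho>_def)
  define \<sigma> where "\<sigma> = 8 * \<rho> / \<mu>"
  have "\<sigma> > 0" using \<rho>(1) \<open>\<mu> > 0\<close> by (simp add: \<sigma>_def)
  have \<sigma>\<mu>: "\<sigma> * \<mu> = 8 * \<rho>" using \<open>\<mu> > 0\<close> by (simp add: \<sigma>_def)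
  have step: "X + v \<in> Q"
    if X: "X \<in> Q \<inter> ball P \<rho>" and v: "norm v \<le> 10 * \<rho>" "(\<mu> / 2) * norm v \<le> m \<bullet> snd v" for X v
  proof -
    have "dist P X < \<rho>" using X by simp
    moreover have "dist P (X + v) \<le> dist P X + norm v"
      using dist_triangle[of P "X + v" X] by (simp add: dist_add_self)
    ultimately have in11: "dist P X < 11 * \<rho>" "dist P (X + v) < 11 * \<rho>" using v(1) \<rho>(1) by linarith+
    then have "\<bar>F (X + v) - F X - (0, m) \<bullet> (X + v - X)\<bar> \<le> (\<mu> / 2) * norm (X + v - X)"
      using \<rho>(2) by (intro r(2)) auto
    then have "\<bar>F (X + v) - F X - m \<bullet> snd v\<bar> \<le> (\<mu> / 2) * norm v" by (simp add: inner_prod_def)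
    then have "F (X + v) \<ge> F X" using v(2) by linarith
    moreover have "X \<in> ball P R" "X + v \<in> ball P R" using in11 \<rho>(3) by auto
    ultimately show ?thesis using assms(4) X by auto
  qed
  show ?thesis
  proof (rule exI[of _ \<rho>], intro conjI \<rho>(1), rule exI[of _ \<sigma>], intro conjI ballI \<open>\<sigma> > 0\<close>)
    fix X and s :: real assume X: "X \<in> Q \<inter> ball P \<rho>" and "s \<in> {0..\<sigma>}"
    then have s: "0 \<le> s" "s \<le> \<sigma>" by auto
    have nrm: "norm (s *\<^sub>R (0::real, m)) = s * \<mu>" unfolding norm_scaleR using s by (simp add: \<mu>_def norm_Pair)
    have "s * \<mu> \<le> \<sigma> * \<mu>" using s \<open>\<mu> > 0\<close> by (intro mult_right_mono) auto
    then have "s * \<mu> \<le> 10 * \<rho>" using \<sigma>\<mu> \<rho>(1) by linarith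
    moreover have "m \<bullet> snd (s *\<^sub>R (0::real, m)) = s * \<mu> * \<mu>"
      by (simp add: \<mu>_def dot_square_norm power2_eq_square)
    moreover have "s * \<mu> * \<mu> \<ge> 0" using s \<open>\<mu> > 0\<close> by simp
    ultimately show "X + s *\<^sub>R (0, m) \<in> Q"
      using nrm by (intro step[OF X]) (auto simp: mult_ac)
  next
    fix X Y and \<theta> :: real
    assume X: "X \<in> Q \<inter> ball P \<rho>" and Y: "Y \<in> Q \<inter> ball P \<rho>" and "\<theta> \<in> {0..1}"
    then have \<theta>: "0 \<le> \<theta>" "\<theta> \<le> 1" by auto
    define d where "d = \<theta> *\<^sub>R (Y - X)"
    have "norm (Y - X) \<le> 2 * \<rho>"
      using X Y dist_triangle[of Y X P] by (simp add: dist_norm[symmetric] dist_commute)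
    then have d: "norm d \<le> 2 * \<rho>"
      unfolding d_def norm_scaleR using \<theta> mult_mono[of "\<bar>\<theta>\<bar>" 1 "norm (Y - X)" "2 * \<rho>"] by simp
    have nrm: "norm (\<sigma> *\<^sub>R (0::real, m)) = 8 * \<rho>"
      unfolding norm_scaleR using \<open>\<sigma> > 0\<close> \<sigma>\<mu> by (simp add: \<mu>_def norm_Pair)
    have n: "norm (\<sigma> *\<^sub>R (0, m) + d) \<le> 10 * \<rho>"
      using norm_triangle_ineq[of "\<sigma> *\<^sub>R (0, m)" d] nrm d by linarith
    have "\<bar>m \<bullet> snd d\<bar> \<le> \<mu> * norm (snd d)" unfolding \<mu>_def by (rule Cauchy_Schwarz_ineq2)
    also have "\<dots> \<le> \<mu> * (2 * \<rho>)"
      using d norm_snd_le[of "snd d" "fst d"] \<open>\<mu> > 0\<close> by (intro mult_left_mono) (auto intro: order_trans)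
    finally have "m \<bullet> snd d \<ge> - (\<mu> * (2 * \<rho>))" by linarith
    moreover have "m \<bullet> snd (\<sigma> *\<^sub>R (0::real, m) + d) = \<sigma> * \<mu> * \<mu> + m \<bullet> snd d"
      by (simp add: inner_add_right \<mu>_def dot_square_norm power2_eq_square)
    moreover have "\<sigma> * \<mu> * \<mu> = 8 * (\<mu> * \<rho>)" by (simp add: \<sigma>\<mu>)
    moreover have "(\<mu> / 2) * norm (\<sigma> *\<^sub>R (0, m) + d) \<le> (\<mu> / 2) * (10 * \<rho>)"
      using n \<open>\<mu> > 0\<close> by (intro mult_left_mono) auto
    ultimately have "(\<mu> / 2) * norm (\<sigma> *\<^sub>R (0, m) + d) \<le> m \<bullet> snd (\<sigma> *\<^sub>R (0, m) + d)"
      using mult_pos_pos[OF \<open>\<mu> > 0\<close> \<rho>(1)] by linarith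
    from step[OF X n this] show "X + \<sigma> *\<^sub>R (0, m) + \<theta> *\<^sub>R (Y - X) \<in> Q"
      by (simp add: d_def add.assoc)
  qed
qed

text \<open>A maximum point of \<open>Q\<close> that is close to \<open>P\<^sub>1\<close> compared with the time difference between \<open>P\<^sub>1\<close> and
  \<open>Y\<close> is not later than \<open>Y\<close>. So it can be joined to \<open>Y\<close> forward in time, even if it is earlier than
  \<open>P\<^sub>1\<close>.\<close>
lemma degenerate_max_locally_constant:
  assumes interior: "\<And>P. P \<in> Q \<Longrightarrow> u P = M \<Longrightarrow>
      \<exists>r>0. \<forall>P'\<in>Q \<inter> ball P r. fst P \<le> fst P' \<longrightarrow> u P' = M"
    and P1: "P\<^sub>1 \<in> T" "u P\<^sub>1 = M"
  shows "\<exists>r>0. \<forall>P'\<in>(Q \<union> T) \<inter> ball P\<^sub>1 r. fst P\<^sub>1 \<le> fst P' \<longrightarrow> u P' = M"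
proof -
  from level_set[OF P1(1)] obtain F m R where R: "0 < R" and bm: "0 < b P\<^sub>1 \<bullet> m"
    and strict: "strict_gradient F P\<^sub>1 (0, m)"
    and Q_iff: "\<forall>X\<in>ball P\<^sub>1 R. X \<in> Q \<longleftrightarrow> 0 < F X" by blast
  have "m \<noteq> 0" using bm by auto
  obtain \<rho> \<sigma> where \<rho>: "0 < \<rho>" "0 < \<sigma>"
    and up: "\<forall>X\<in>Q \<inter> ball P\<^sub>1 \<rho>. \<forall>s\<in>{0..\<sigma>}. X + s *\<^sub>R (0, m) \<in> Q"
    and across: "\<forall>X\<in>Q \<inter> ball P\<^sub>1 \<rho>. \<forall>Y\<in>Q \<inter> ball P\<^sub>1 \<rho>. \<forall>\<theta>\<in>{0..1}.
      X + \<sigma> *\<^sub>R (0, m) + \<theta> *\<^sub>R (Y - X) \<in> Q"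
    using points_connected_near_degenerate_boundary[OF strict \<open>m \<noteq> 0\<close> R Q_iff] by (elim exE conjE)
  have uQ: "continuous_on Q u" using u_cont by (rule continuous_on_subset) auto
  have seg: "u Y = M" if "u X = M" "fst X \<le> fst Y" "\<And>\<theta>. 0 \<le> \<theta> \<Longrightarrow> \<theta> \<le> 1 \<Longrightarrow> X + \<theta> *\<^sub>R (Y - X) \<in> Q"
    for X Y
    by (rule max_propagates_along_segment[OF uQ _ that(3,2,1)]) (rule interior)
  have later: "u Y = M" if Y: "Y \<in> Q \<inter> ball P\<^sub>1 \<rho>" "fst P\<^sub>1 < fst Y" for Y
  proof -
    define r where "r = min \<rho> (fst Y - fst P\<^sub>1)"
    have "r > 0" using \<rho>(1) Y(2) by (simp add: r_def)
    then obtain X where X: "X \<in> Q" "X \<in> ball P\<^sub>1 r" "u X = M"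
      using degenerate_max_approached_from_interior[OF P1] by blast
    have X\<rho>: "X \<in> Q \<inter> ball P\<^sub>1 \<rho>" using X by (simp add: r_def)
    have "dist P\<^sub>1 X < fst Y - fst P\<^sub>1" using X(2) by (simp add: r_def)
    then have "fst X \<le> fst Y"
      using dist_fst_le[of P\<^sub>1 X] by (simp add: dist_real_def)
    have "u (X + \<sigma> *\<^sub>R (0, m)) = M"
    proof (rule seg[of X])
      fix \<theta> :: real assume "0 \<le> \<theta>" "\<theta> \<le> 1"
      then have "\<theta> * \<sigma> \<in> {0..\<sigma>}" using \<rho>(2) by (auto simp: mult_left_le_one_le)
      from up[rule_format, OF X\<rho> this] show "X + \<theta> *\<^sub>R (X + \<sigma> *\<^sub>R (0, m) - X) \<in> Q" by simp
    qed (use X in auto)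
    then have "u (Y + \<sigma> *\<^sub>R (0, m)) = M"
    proof (rule seg)
      fix \<theta> :: real assume "0 \<le> \<theta>" "\<theta> \<le> 1"
      then have "\<theta> \<in> {0..1}" by simp
      from across[rule_format, OF X\<rho> Y(1) this]
      show "X + \<sigma> *\<^sub>R (0, m) + \<theta> *\<^sub>R (Y + \<sigma> *\<^sub>R (0, m) - (X + \<sigma> *\<^sub>R (0, m))) \<in> Q" by simp
    qed (use \<open>fst X \<le> fst Y\<close> in auto)
    then show "u Y = M"
    proof (rule seg)
      fix \<theta> :: real assume "0 \<le> \<theta>" "\<theta> \<le> 1"
      then have "(1 - \<theta>) * \<sigma> \<in> {0..\<sigma>}" using \<rho>(2) by (auto simp: mult_left_le_one_le)
      from up[rule_format, OF Y(1) this] show "Y + \<sigma> *\<^sub>R (0, m) + \<theta> *\<^sub>R (Y - (Y + \<sigma> *\<^sub>R (0, m))) \<in> Q"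
        by (simp add: algebra_simps)
    qed auto
  qed
  have "u Y = M" if Y: "Y \<in> Q \<union> T" "Y \<in> ball P\<^sub>1 \<rho>" "fst P\<^sub>1 \<le> fst Y" for Y
  proof -
    obtain v \<delta> where \<delta>: "\<delta> > 0" "\<And>s. 0 < s \<Longrightarrow> s < \<delta> \<Longrightarrow> Y + s *\<^sub>R (1, v) \<in> Q"
    proof (cases "Y \<in> T")
      case True
      from level_set[OF this] obtain F' m' R' where "0 < R'" "0 < b Y \<bullet> m'" "F' Y = 0"
        "strict_gradient F' Y (0, m')" "\<And>X. X \<in> ball Y R' \<Longrightarrow> (X \<in> Q \<longleftrightarrow> 0 < F' X)" by blast
      then have "\<exists>\<delta>>0. \<forall>s. 0 < s \<and> s < \<delta> \<longrightarrow> Y + s *\<^sub>R (1, b Y) \<in> Q"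
        using inward_direction[OF True, of F' m' R' "b Y"] by (simp add: inner_commute)
      then show ?thesis using that[of _ "b Y"] by blast
    next
      case False
      then obtain d where d: "d > 0" "ball Y d \<subseteq> Q" using Y(1) open_Q open_contains_ball by blast
      have "Y + s *\<^sub>R (1, 0) \<in> Q" if "0 < s" "s < d" for s
      proof -
        have "dist Y (Y + s *\<^sub>R (1, 0)) = s" unfolding dist_add_self norm_scaleR using that by (simp add: norm_Pair)
        then show ?thesis using d(2) that by auto
      qed
      then show ?thesis using that d(1) by blast
    qed
    define L where "L s = Y + s *\<^sub>R (1, v)" for s :: real
    have "(L \<longlongrightarrow> Y + 0 *\<^sub>R (1, v)) (at_right 0)" unfolding L_def by (intro tendsto_intros)
    moreover have "Y + 0 *\<^sub>R (1, v) = Y" by (cases Y) simp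
    ultimately have L_lim: "(L \<longlongrightarrow> Y) (at_right 0)" by simp
    have "\<forall>\<^sub>F s in at_right 0. s \<in> {0<..<\<delta>}" using \<delta>(1) by (rule eventually_at_right_real)
    then have ev: "\<forall>\<^sub>F s in at_right 0. L s \<in> Q \<and> fst P\<^sub>1 < fst (L s)"
      by eventually_elim (use \<delta>(2) Y(3) in \<open>auto simp: L_def\<close>)
    have "\<forall>\<^sub>F s in at_right 0. L s \<in> ball P\<^sub>1 \<rho>"
      using L_lim Y(2) by (intro topological_tendstoD) auto
    then have "\<forall>\<^sub>F s in at_right 0. u (L s) = M"
      using ev by eventually_elim (use later in auto)
    then have "((\<lambda>s. u (L s)) \<longlongrightarrow> M) (at_right 0)" by (rule tendsto_eventually)
    moreover have "((\<lambda>s. u (L s)) \<longlongrightarrow> u Y) (at_right 0)"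
      by (rule continuous_on_tendsto_compose[OF u_cont L_lim Y(1)]) (use ev in \<open>auto elim: eventually_mono\<close>)
    ultimately show ?thesis by (intro tendsto_unique[of "at_right (0::real)"]) auto
  qed
  then show ?thesis using \<rho>(1) by blast
qed

end

section \<open>The strong maximum principle\<close>

lemma gderiv_space_grad:
  assumes "(\<lambda>x. u (fst P, x)) differentiable at (snd P)"
  shows "GDERIV (\<lambda>x. u (fst P, x)) (snd P) :> space_grad u P"
proof -
  let ?f = "\<lambda>x. u (fst P, x)"
  obtain f' where f': "(?f has_derivative f') (at (snd P))"
    using assms by (auto simp: differentiable_def)
  have "f' = (\<lambda>v. v \<bullet> adjoint f' 1)"
    using adjoint_works[OF has_derivative_linear[OF f'], of _ 1] by (simp add: fun_eq_iff)
  with f' have "(?f has_derivative (\<lambda>v. v \<bullet> adjoint f' 1)) (at (snd P))" by simp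
  then obtain g where g: "(?f has_derivative (\<lambda>v. v \<bullet> g)) (at (snd P))" ..
  have "space_grad u P = g"
    unfolding space_grad_def gderiv_def
  proof (rule the_equality)
    show "(?f has_derivative (\<lambda>v. v \<bullet> g)) (at (snd P))" by (rule g)
    show "g' = g" if "(?f has_derivative (\<lambda>v. v \<bullet> g')) (at (snd P))" for g'
    proof -
      have "(\<lambda>v. v \<bullet> g') = (\<lambda>v. v \<bullet> g)"
        using that g by (rule has_derivative_unique)
      then show ?thesis by (simp add: fun_eq_iff vector_eq_ldot)
    qed
  qed
  then show ?thesis unfolding gderiv_def using g by (rule ssubst)
qed

theorem theorem5p13:
  fixes Q :: "(real \<times> (real^'n)) set"
    and a :: "real \<times> (real^'n) \<Rightarrow> real^'n^'n"
    and b :: "real \<times> (real^'n) \<Rightarrow> real^'n"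
    and c u :: "real \<times> (real^'n) \<Rightarrow> real"
    and P0 :: "real \<times> (real^'n)"
    and \<alpha> :: real
  defines "d0Q \<equiv> degenerate_boundary Q a"
    and "Q' \<equiv> with_degenerate_boundary Q a"
  assumes Q_open: "open Q"
    and a_nonneg: "\<forall>P\<in>Q. nonneg_definite_symmetric (a P)"
    and a_d0Q: "\<forall>P\<in>d0Q. a P = 0"
    and d0Q_portion: "0 < \<alpha>" "\<alpha> \<le> 1" "C1_holder_boundary_portion \<alpha> Q d0Q"
    and a_locally_strictly_pos:
      "\<forall>P\<in>Q. \<exists>r>0. \<exists>\<epsilon>>0. \<forall>P'\<in>ball P r \<inter> Q. \<epsilon> \<le> smallest_eigenvalue (a P')"
    and b_perp_pos: "\<forall>P\<in>d0Q. 0 < b_perp Q b P"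
    and c_nonneg: "\<forall>P\<in>Q'. 0 \<le> c P"
    and b_bounded: "locally_bounded_on Q' b"
    and c_bounded: "locally_bounded_on Q' c"
    and a_cont: "\<forall>P\<in>d0Q. continuous (at P within Q') a"
    and b_cont: "\<forall>P\<in>d0Q. continuous (at P within Q') b"
    and a_bounded: "locally_bounded_on Q a"
    and u_C2s: "u \<in> C2s Q a"
    and subsolution: "\<forall>P\<in>Q. parabolic_op a b c u P \<le> 0"
    and maximum: "P0 \<in> Q'" "\<forall>P\<in>Q'. u P \<le> u P0" "0 < u P0"
  shows "\<forall>P\<in>time_reachable Q' P0. u P = u P0"
proof -
  have Q': "Q' = Q \<union> d0Q" by (simp add: Q'_def d0Q_def with_degenerate_boundary_def)
  define D2u where "D2u P = space_hessian u P" for P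
  have u_time_diff: "\<forall>P\<in>Q. (\<lambda>t. u (t, snd P)) differentiable at (fst P)"
    and u_space_diff: "\<forall>P\<in>Q. (\<lambda>x. u (fst P, x)) differentiable at (snd P)"
    and grad_diff: "\<forall>P\<in>Q. (\<lambda>x. space_grad u (fst P, x)) differentiable at (snd P)"
    and cont_u: "continuous_on Q' u"
    and grad_ext: "\<exists>G. continuous_on Q' G \<and> (\<forall>P\<in>Q. G P = space_grad u P)"
    and trace_ext: "\<exists>h. continuous_on Q' h \<and> (\<forall>P\<in>Q. h P = trace (a P ** D2u P)) \<and> (\<forall>P\<in>d0Q. h P = 0)"
    using u_C2s unfolding C2s_def Q'_def d0Q_def D2u_def by auto
  obtain G where G: "continuous_on Q' G" "\<forall>P\<in>Q. G P = space_grad u P" using grad_ext by blast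
  obtain h where h: "continuous_on Q' h" "\<forall>P\<in>Q. h P = trace (a P ** D2u P)" "\<forall>P\<in>d0Q. h P = 0"
    using trace_ext by blast
  interpret positive_subsolution Q a b u "time_deriv u" "space_grad u" D2u
  proof
    show "open Q" by (rule Q_open)
  next
    fix P assume P: "P \<in> Q"
    show "nonneg_definite_symmetric (a P)" using a_nonneg P by blast
    show "((\<lambda>t. u (t, snd P)) has_real_derivative time_deriv u P) (at (fst P))"
      unfolding time_deriv_def using u_time_diff P
      by (simp add: DERIV_deriv_iff_real_differentiable)
    show "GDERIV (\<lambda>x. u (fst P, x)) (snd P) :> space_grad u P"
      using u_space_diff P by (intro gderiv_space_grad) blast
    show "((\<lambda>x. space_grad u (fst P, x)) has_derivative (\<lambda>h. D2u P *v h)) (at (snd P))"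
      unfolding D2u_def space_hessian_def using grad_diff P jacobian_works by blast
    assume "0 \<le> u P"
    then have "0 \<le> c P * u P" using c_nonneg P Q' by simp
    then show "0 \<le> time_deriv u P + trace (a P ** D2u P) + b P \<bullet> space_grad u P"
      using subsolution P by (fastforce simp: parabolic_op_def D2u_def)
  qed
  interpret degenerate_subsolution Q a b u "time_deriv u" "space_grad u" D2u d0Q G h "u P0"
  proof
    fix P assume P: "P \<in> d0Q"
    obtain F m R where F: "R > 0" "m \<noteq> 0" "inward_normal Q P = (1 / norm m) *\<^sub>R m" "F P = 0"
      "continuous_on (ball P R) F" "strict_gradient F P (0, m)"
      "Q \<inter> ball P R = {X \<in> ball P R. 0 < F X}" "d0Q \<inter> ball P R = {X \<in> ball P R. F X = 0}"
      unfolding d0Q_def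
      by (rule degenerate_boundary_level_set[OF Q_open d0Q_portion(1) d0Q_portion(3)[unfolded d0Q_def]
            P[unfolded d0Q_def]])
    have "0 < b P \<bullet> ((1 / norm m) *\<^sub>R m)"
      using b_perp_pos P unfolding b_perp_def F(3)[symmetric] by blast
    then have "0 < b P \<bullet> m" using F(2) by (simp add: zero_less_divide_iff)
    moreover have "(X \<in> Q \<longleftrightarrow> 0 < F X) \<and> (X \<in> d0Q \<longleftrightarrow> F X = 0)" if "X \<in> ball P R" for X
    proof -
      have "X \<in> Q \<inter> ball P R \<longleftrightarrow> X \<in> {X \<in> ball P R. 0 < F X}"
        "X \<in> d0Q \<inter> ball P R \<longleftrightarrow> X \<in> {X \<in> ball P R. F X = 0}"
        by (simp_all only: F(7,8))
      then show ?thesis using that by simp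
    qed
    ultimately show "\<exists>F m R. 0 < R \<and> 0 < b P \<bullet> m \<and> F P = 0 \<and>
      continuous_on (ball P R) F \<and> strict_gradient F P (0, m) \<and>
      (\<forall>X\<in>ball P R. (X \<in> Q \<longleftrightarrow> 0 < F X) \<and> (X \<in> d0Q \<longleftrightarrow> F X = 0))"
      using F(1,4,5,6) by blast
    show "continuous (at P within Q \<union> d0Q) a" "a P = 0" "continuous (at P within Q \<union> d0Q) b" "h P = 0"
      using a_cont a_d0Q b_cont h(3) P unfolding Q' by blast+
  next
    fix P assume "P \<in> Q"
    then show "G P = space_grad u P" "h P = trace (a P ** D2u P)" using G(2) h(2) by blast+
  next
    fix P assume "P \<in> Q \<union> d0Q"
    then show "u P \<le> u P0" using maximum(2) unfolding Q' by blast
  qed (use cont_u G(1) h(1) maximum(3) in \<open>simp_all add: Q'\<close>)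
  have "locally_bounded_on Q b"
    unfolding locally_bounded_on_def
  proof
    fix P assume "P \<in> Q"
    then obtain r where r: "r > 0" "bounded (b ` (ball P r \<inter> Q'))"
      using b_bounded Q' unfolding locally_bounded_on_def by blast
    have "bounded (b ` (ball P r \<inter> Q))"
      using r(2) by (rule bounded_subset) (auto simp: Q')
    with r(1) show "\<exists>r>0. bounded (b ` (ball P r \<inter> Q))" by blast
  qed
  moreover have "continuous_on Q u" using cont_u by (rule continuous_on_subset) (simp add: Q')
  ultimately have interior: "\<exists>r>0. \<forall>P'\<in>Q \<inter> ball P r. fst P \<le> fst P' \<longrightarrow> u P' = u P0"
    if "P \<in> Q" "u P = u P0" for P
    using that a_locally_strictly_pos a_bounded maximum(2,3) Q'
    by (intro interior_max_locally_constant) auto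
  have propagates: "\<exists>r>0. \<forall>P'\<in>Q' \<inter> ball P r. fst P \<le> fst P' \<longrightarrow> u P' = u P0"
    if P: "P \<in> Q'" "u P = u P0" for P
  proof (cases "P \<in> d0Q")
    case True
    then show ?thesis
      using degenerate_max_locally_constant[OF interior True P(2)] unfolding Q' by blast
  next
    case False
    then have "P \<in> Q" using P(1) Q' by blast
    then obtain r where r: "r > 0" "\<forall>P'\<in>Q \<inter> ball P r. fst P \<le> fst P' \<longrightarrow> u P' = u P0"
      using interior P(2) by blast
    obtain r' where r': "r' > 0" "ball P r' \<subseteq> Q" using Q_open \<open>P \<in> Q\<close> open_contains_ball by blast
    have "\<forall>P'\<in>Q' \<inter> ball P (min r r'). fst P \<le> fst P' \<longrightarrow> u P' = u P0"
      using r(2) r'(2) by auto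
    moreover have "min r r' > 0" using r(1) r'(1) by simp
    ultimately show ?thesis by blast
  qed
  show ?thesis
  proof
    fix P assume "P \<in> time_reachable Q' P0"
    then obtain g where g: "simple_path g" "path_image g \<subseteq> Q'" "pathstart g = P" "pathfinish g = P0"
      "monotone_on {0..1} (\<le>) (\<ge>) (fst \<circ> g)"
      unfolding time_reachable_def by blast
    \<comment> \<open>the path runs from \<open>P\<close> back in time to \<open>P0\<close>, so it is followed in the opposite direction\<close>
    have "mono_on {0..1} (fst \<circ> reversepath g)"
      using g(5) by (auto simp: monotone_on_def reversepath_def)
    then have "u (pathfinish (reversepath g)) = u P0"
      using g simple_path_imp_path[OF g(1)]
      by (intro max_propagates_along_path[OF cont_u _ _ _ \<open>mono_on {0..1} (fst \<circ> reversepath g)\<close>] propagates) auto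
    then show "u P = u P0" using g(3) by simp
  qed
qed

end
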